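(* The FI-module $n\mapsto H^*(Y_n,\mathbb{Z}_2)$ over $\mathbb{Z}_2$, where $Y_n=\mathrm{Hom}(\mathbb{Z}^n,SU(2))$, is not a finitely generated FI-module.
   Context: $\mathrm{Hom}(\mathbb{Z}^n,SU(2))$ is the space of commuting $n$-tuples in $SU(2)$, topologized as a subspace of $SU(2)^n$. FI is the category of finite sets and injections; an FI-module over a field $\mathbb{F}$ is a functor from FI to $\mathbb{F}$-vector spaces, and it is finitely generated if there is a finite set of elements of the spaces $V_m$ that is not contained in any proper sub-FI-module. The FI-module structure on $H^*(Y_n,\mathbb{F})$ is given by the $S_n$-action permuting the entries of commuting $n$-tuples and by the maps $\varphi_n^*:H^*(Y_n,\mathbb{F})\to H^*(Y_{n+1},\mathbb{F})$ induced by the projection $Y_{n+1}\to Y_n$ onto the first $n$ entries; that is, an injection $f:\{1,\dots,m\}\to\{1,\dots,n\}$ acts by pullback along $Y_n\to Y_m$, $(g_1,\dots,g_n)\mapsto(g_{f(1)},\dots,g_{f(m)})$. *)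

theory Defs
  imports
    "HOL-Analysis.Analysis"
    "HOL-Homology.Homology"
    "HOL-Algebra.Module"
    "HOL-Algebra.AbelCoset"
    "HOL-Number_Theory.Residues"
begin

section \<open>Modules\<close>

text \<open>
  The records for modules extend those for rings; the ring fields \<open>mult\<close> and \<open>one\<close> have no
  meaning for a module and are left \<open>undefined\<close>.  A vector space over \<open>F\<close> is a \<open>module F\<close> with
  \<open>field F\<close>.
\<close>

definition mod_hom ::
  "('k, 'r) ring_scheme \<Rightarrow> ('k, 'a, 's) module_scheme \<Rightarrow> ('k, 'b, 't) module_scheme \<Rightarrow> ('a \<Rightarrow> 'b) set"
  where "mod_hom F M N =
    {h \<in> carrier M \<rightarrow> carrier N.
       (\<forall>x\<in>carrier M. \<forall>y\<in>carrier M. h (x \<oplus>\<^bsub>M\<^esub> y) = h x \<oplus>\<^bsub>N\<^esub> h y) \<and>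
       (\<forall>a\<in>carrier F. \<forall>x\<in>carrier M. h (a \<odot>\<^bsub>M\<^esub> x) = a \<odot>\<^bsub>N\<^esub> h x)}"

definition quotient_module :: "('k, 'a) module \<Rightarrow> 'a set \<Rightarrow> ('k, 'a set) module"
  where "quotient_module M N =
    \<lparr>carrier = a_rcosets\<^bsub>M\<^esub> N, mult = undefined, one = undefined, zero = N, add = set_add M,
     smult = (\<lambda>a A. \<Union>x\<in>A. N +>\<^bsub>M\<^esub> (a \<odot>\<^bsub>M\<^esub> x))\<rparr>"

definition direct_sum_module :: "('i \<Rightarrow> ('k, 'a) module) \<Rightarrow> ('k, 'i \<Rightarrow> 'a) module"
  where "direct_sum_module M =
    \<lparr>carrier = {x. (\<forall>i. x i \<in> carrier (M i)) \<and> finite {i. x i \<noteq> \<zero>\<^bsub>M i\<^esub>}},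
     mult = undefined, one = undefined,
     zero = (\<lambda>i. \<zero>\<^bsub>M i\<^esub>),
     add = (\<lambda>x y i. x i \<oplus>\<^bsub>M i\<^esub> y i),
     smult = (\<lambda>a x i. a \<odot>\<^bsub>M i\<^esub> x i)\<rparr>"

section \<open>Singular cohomology with coefficients\<close>

definition cochain_module ::
  "('k, 'r) ring_scheme \<Rightarrow> nat \<Rightarrow> 'a topology \<Rightarrow> ('k, ((nat \<Rightarrow> real) \<Rightarrow> 'a) \<Rightarrow> 'k) module"
  where "cochain_module F p X =
    \<lparr>carrier = singular_simplex_set p X \<rightarrow>\<^sub>E carrier F,
     mult = undefined, one = undefined,
     zero = (\<lambda>\<sigma>\<in>singular_simplex_set p X. \<zero>\<^bsub>F\<^esub>),
     add = (\<lambda>c d. \<lambda>\<sigma>\<in>singular_simplex_set p X. c \<sigma> \<oplus>\<^bsub>F\<^esub> d \<sigma>),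
     smult = (\<lambda>a c. \<lambda>\<sigma>\<in>singular_simplex_set p X. a \<otimes>\<^bsub>F\<^esub> c \<sigma>)\<rparr>"

text \<open>The coboundary from degree \<open>p\<close> to degree \<open>p + 1\<close>, dual to \<^const>\<open>chain_boundary\<close>.\<close>

definition coboundary ::
  "('k, 'r) ring_scheme \<Rightarrow> nat \<Rightarrow> 'a topology
     \<Rightarrow> (((nat \<Rightarrow> real) \<Rightarrow> 'a) \<Rightarrow> 'k) \<Rightarrow> ((nat \<Rightarrow> real) \<Rightarrow> 'a) \<Rightarrow> 'k"
  where "coboundary F p X c =
    (\<lambda>\<sigma>\<in>singular_simplex_set (Suc p) X.
       \<Oplus>\<^bsub>F\<^esub>i\<in>{..Suc p}. ((\<ominus>\<^bsub>F\<^esub> \<one>\<^bsub>F\<^esub>) [^]\<^bsub>F\<^esub> i) \<otimes>\<^bsub>F\<^esub> c (singular_face (Suc p) i \<sigma>))"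

definition cocycles ::
  "('k, 'r) ring_scheme \<Rightarrow> nat \<Rightarrow> 'a topology \<Rightarrow> (((nat \<Rightarrow> real) \<Rightarrow> 'a) \<Rightarrow> 'k) set"
  where "cocycles F p X =
    {c \<in> carrier (cochain_module F p X). coboundary F p X c = \<zero>\<^bsub>cochain_module F (Suc p) X\<^esub>}"

definition coboundaries ::
  "('k, 'r) ring_scheme \<Rightarrow> nat \<Rightarrow> 'a topology \<Rightarrow> (((nat \<Rightarrow> real) \<Rightarrow> 'a) \<Rightarrow> 'k) set"
  where "coboundaries F p X =
    (case p of
       0 \<Rightarrow> {\<zero>\<^bsub>cochain_module F 0 X\<^esub>}
     | Suc q \<Rightarrow> coboundary F q X ` carrier (cochain_module F q X))"

definition cohomology_module ::
  "('k, 'r) ring_scheme \<Rightarrow> nat \<Rightarrow> 'a topology \<Rightarrow> ('k, (((nat \<Rightarrow> real) \<Rightarrow> 'a) \<Rightarrow> 'k) set) module"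
  where "cohomology_module F p X =
    quotient_module ((cochain_module F p X)\<lparr>carrier := cocycles F p X\<rparr>) (coboundaries F p X)"

definition cochain_pullback ::
  "nat \<Rightarrow> 'a topology \<Rightarrow> ('a \<Rightarrow> 'b) \<Rightarrow> (((nat \<Rightarrow> real) \<Rightarrow> 'b) \<Rightarrow> 'k) \<Rightarrow> ((nat \<Rightarrow> real) \<Rightarrow> 'a) \<Rightarrow> 'k"
  where "cochain_pullback p X g c = (\<lambda>\<sigma>\<in>singular_simplex_set p X. c (simplex_map p g \<sigma>))"

text \<open>
  The map \<open>H\<^sup>p(Y) \<rightarrow> H\<^sup>p(X)\<close> induced by a continuous map \<open>g\<close> from \<open>X\<close> to \<open>Y\<close>; the union is over the
  representatives of a class and all its members coincide.
\<close>

definition cohomology_map ::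
  "('k, 'r) ring_scheme \<Rightarrow> nat \<Rightarrow> 'a topology \<Rightarrow> ('a \<Rightarrow> 'b)
     \<Rightarrow> (((nat \<Rightarrow> real) \<Rightarrow> 'b) \<Rightarrow> 'k) set \<Rightarrow> (((nat \<Rightarrow> real) \<Rightarrow> 'a) \<Rightarrow> 'k) set"
  where "cohomology_map F p X g A =
    (\<Union>c\<in>A. coboundaries F p X +>\<^bsub>cochain_module F p X\<^esub> cochain_pullback p X g c)"

text \<open>\<open>H\<^sup>*(X; F)\<close> is the direct sum of the cohomology spaces in all degrees.\<close>

definition total_cohomology ::
  "('k, 'r) ring_scheme \<Rightarrow> 'a topology \<Rightarrow> ('k, nat \<Rightarrow> (((nat \<Rightarrow> real) \<Rightarrow> 'a) \<Rightarrow> 'k) set) module"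
  where "total_cohomology F X = direct_sum_module (\<lambda>p. cohomology_module F p X)"

definition total_cohomology_map ::
  "('k, 'r) ring_scheme \<Rightarrow> 'a topology \<Rightarrow> ('a \<Rightarrow> 'b)
     \<Rightarrow> (nat \<Rightarrow> (((nat \<Rightarrow> real) \<Rightarrow> 'b) \<Rightarrow> 'k) set) \<Rightarrow> nat \<Rightarrow> (((nat \<Rightarrow> real) \<Rightarrow> 'a) \<Rightarrow> 'k) set"
  where "total_cohomology_map F X g x = (\<lambda>p. cohomology_map F p X g (x p))"

section \<open>FI-modules\<close>

text \<open>
  FI is represented by its skeleton on the sets \<open>{1..n}\<close>: \<open>fi_hom m n\<close> is the set of injections
  \<open>{1..m} \<rightarrow> {1..n}\<close>.
\<close>

definition fi_hom :: "nat \<Rightarrow> nat \<Rightarrow> (nat \<Rightarrow> nat) set"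
  where "fi_hom m n = {f \<in> {1..m} \<rightarrow>\<^sub>E {1..n}. inj_on f {1..m}}"

locale fi_module = field F
  for F :: "('k, 'r) ring_scheme" (structure)
    and V :: "nat \<Rightarrow> ('k, 'v, 's) module_scheme"
    and T :: "nat \<Rightarrow> nat \<Rightarrow> (nat \<Rightarrow> nat) \<Rightarrow> 'v \<Rightarrow> 'v" +
  assumes module: "module F (V n)"
    and linear: "f \<in> fi_hom m n \<Longrightarrow> T m n f \<in> mod_hom F (V m) (V n)"
    and identity: "x \<in> carrier (V n) \<Longrightarrow> T n n (\<lambda>i\<in>{1..n}. i) x = x"
    and composition:
      "\<lbrakk>f \<in> fi_hom l m; g \<in> fi_hom m n; x \<in> carrier (V l)\<rbrakk>
         \<Longrightarrow> T l n (compose {1..l} g f) x = T m n g (T l m f x)"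

definition sub_fi_module ::
  "('k, 'r) ring_scheme \<Rightarrow> (nat \<Rightarrow> ('k, 'v, 's) module_scheme)
     \<Rightarrow> (nat \<Rightarrow> nat \<Rightarrow> (nat \<Rightarrow> nat) \<Rightarrow> 'v \<Rightarrow> 'v) \<Rightarrow> (nat \<Rightarrow> 'v set) \<Rightarrow> bool"
  where "sub_fi_module F V T W \<longleftrightarrow>
    (\<forall>n. submodule (W n) F (V n)) \<and> (\<forall>m n. \<forall>f\<in>fi_hom m n. T m n f ` W m \<subseteq> W n)"

text \<open>A pair \<open>(m, x)\<close> stands for the element \<open>x\<close> of \<open>V m\<close>.\<close>

definition fi_finitely_generated ::
  "('k, 'r) ring_scheme \<Rightarrow> (nat \<Rightarrow> ('k, 'v, 's) module_scheme)
     \<Rightarrow> (nat \<Rightarrow> nat \<Rightarrow> (nat \<Rightarrow> nat) \<Rightarrow> 'v \<Rightarrow> 'v) \<Rightarrow> bool"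
  where "fi_finitely_generated F V T \<longleftrightarrow>
    (\<exists>G \<subseteq> (SIGMA m:UNIV. carrier (V m)). finite G \<and>
       (\<forall>W. sub_fi_module F V T W \<and> G \<subseteq> (SIGMA m:UNIV. W m) \<longrightarrow> (\<forall>n. W n = carrier (V n))))"

section \<open>Commuting tuples in SU(2)\<close>

definition SU2 :: "(complex^2^2) set"
  where "SU2 = {A. A ** (\<chi> i j. cnj (A $ j $ i)) = mat 1 \<and> det A = 1}"

definition commuting_tuples :: "nat \<Rightarrow> (nat \<Rightarrow> complex^2^2) topology"
  where "commuting_tuples n =
    subtopology (product_topology (\<lambda>_. top_of_set SU2) {1..n})
      {g. \<forall>i\<in>{1..n}. \<forall>j\<in>{1..n}. g i ** g j = g j ** g i}"

text \<open>
  An injection \<open>f : {1..m} \<rightarrow> {1..n}\<close> induces \<open>commuting_tuples n \<rightarrow> commuting_tuples m\<close> by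
  reindexing, and hence a map from \<open>H\<^sup>*\<close> of \<open>commuting_tuples m\<close> to that of \<open>commuting_tuples n\<close>.
\<close>

definition reindex :: "nat \<Rightarrow> (nat \<Rightarrow> nat) \<Rightarrow> (nat \<Rightarrow> complex^2^2) \<Rightarrow> nat \<Rightarrow> complex^2^2"
  where "reindex m f g = (\<lambda>i\<in>{1..m}. g (f i))"

definition commuting_cohomology ::
  "('k, 'r) ring_scheme \<Rightarrow> nat
     \<Rightarrow> ('k, nat \<Rightarrow> (((nat \<Rightarrow> real) \<Rightarrow> nat \<Rightarrow> complex^2^2) \<Rightarrow> 'k) set) module"
  where "commuting_cohomology F n = total_cohomology F (commuting_tuples n)"

definition commuting_cohomology_map ::
  "('k, 'r) ring_scheme \<Rightarrow> nat \<Rightarrow> nat \<Rightarrow> (nat \<Rightarrow> nat)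
     \<Rightarrow> (nat \<Rightarrow> (((nat \<Rightarrow> real) \<Rightarrow> nat \<Rightarrow> complex^2^2) \<Rightarrow> 'k) set)
     \<Rightarrow> nat \<Rightarrow> (((nat \<Rightarrow> real) \<Rightarrow> nat \<Rightarrow> complex^2^2) \<Rightarrow> 'k) set"
  where "commuting_cohomology_map F m n f =
    total_cohomology_map F (commuting_tuples n) (reindex m f)"

section \<open>The cohomology of commuting tuples is an FI-module\<close>

lemma module_homI:
  assumes "\<And>x. x \<in> carrier M \<Longrightarrow> h x \<in> carrier N"
    and "\<And>x y. \<lbrakk>x \<in> carrier M; y \<in> carrier M\<rbrakk> \<Longrightarrow> h (x \<oplus>\<^bsub>M\<^esub> y) = h x \<oplus>\<^bsub>N\<^esub> h y"
    and "\<And>a x. \<lbrakk>a \<in> carrier F; x \<in> carrier M\<rbrakk> \<Longrightarrow> h (a \<odot>\<^bsub>M\<^esub> x) = a \<odot>\<^bsub>N\<^esub> h x"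
  shows "h \<in> mod_hom F M N"
  using assms by (auto simp: mod_hom_def)

lemma module_homD:
  assumes "h \<in> mod_hom F M N"
  shows "x \<in> carrier M \<Longrightarrow> h x \<in> carrier N"
    and "\<lbrakk>x \<in> carrier M; y \<in> carrier M\<rbrakk> \<Longrightarrow> h (x \<oplus>\<^bsub>M\<^esub> y) = h x \<oplus>\<^bsub>N\<^esub> h y"
    and "\<lbrakk>a \<in> carrier F; x \<in> carrier M\<rbrakk> \<Longrightarrow> h (a \<odot>\<^bsub>M\<^esub> x) = a \<odot>\<^bsub>N\<^esub> h x"
  using assms by (auto simp: mod_hom_def)

lemma module_hom_zero_minus:
  assumes "module F M" "module F N" "h \<in> mod_hom F M N"
  shows "h \<zero>\<^bsub>M\<^esub> = \<zero>\<^bsub>N\<^esub>" and "x \<in> carrier M \<Longrightarrow> h (\<ominus>\<^bsub>M\<^esub> x) = \<ominus>\<^bsub>N\<^esub> h x"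
proof -
  interpret M: module F M by fact
  interpret N: module F N by fact
  note h = module_homD[OF assms(3)]
  have "h (\<zero>\<^bsub>F\<^esub> \<odot>\<^bsub>M\<^esub> \<zero>\<^bsub>M\<^esub>) = \<zero>\<^bsub>F\<^esub> \<odot>\<^bsub>N\<^esub> h \<zero>\<^bsub>M\<^esub>"
    by (rule h) auto
  then show z: "h \<zero>\<^bsub>M\<^esub> = \<zero>\<^bsub>N\<^esub>" using h(1) by simp
  show "h (\<ominus>\<^bsub>M\<^esub> x) = \<ominus>\<^bsub>N\<^esub> h x" if x: "x \<in> carrier M"
  proof -
    have "h (\<ominus>\<^bsub>M\<^esub> x) \<oplus>\<^bsub>N\<^esub> h x = \<zero>\<^bsub>N\<^esub>"
      using h(2)[of "\<ominus>\<^bsub>M\<^esub> x" x] x z by (simp add: M.l_neg)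
    then show ?thesis using x h(1) by (simp add: N.minus_equality)
  qed
qed

lemma submodule_image:
  assumes "module F M" "module F N" "h \<in> mod_hom F M N"
  shows "submodule (h ` carrier M) F N"
proof -
  interpret M: module F M by fact
  interpret N: module F N by fact
  note h = module_homD[OF assms(3)] and h0 = module_hom_zero_minus[OF assms]
  show ?thesis
  proof (rule N.submoduleI)
    show "h ` carrier M \<subseteq> carrier N" using h(1) by auto
    show "\<zero>\<^bsub>N\<^esub> \<in> h ` carrier M" using h0(1) M.zero_closed by (metis imageI)
    show "\<ominus>\<^bsub>N\<^esub> a \<in> h ` carrier M" if "a \<in> h ` carrier M" for a
      using that h0(2) M.a_inv_closed by (metis (no_types, lifting) imageE imageI)
    show "a \<oplus>\<^bsub>N\<^esub> b \<in> h ` carrier M" if "a \<in> h ` carrier M" "b \<in> h ` carrier M" for a b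
      using that h(2) M.a_closed by (metis (no_types, lifting) imageE imageI)
    show "a \<odot>\<^bsub>N\<^esub> b \<in> h ` carrier M" if "a \<in> carrier F" "b \<in> h ` carrier M" for a b
      using that h(3) M.smult_closed by (metis (no_types, lifting) imageE imageI)
  qed
qed

lemma submodule_kernel:
  assumes "module F M" "module F N" "h \<in> mod_hom F M N"
  shows "submodule {x \<in> carrier M. h x = \<zero>\<^bsub>N\<^esub>} F M"
proof -
  interpret M: module F M by fact
  interpret N: module F N by fact
  note h = module_homD[OF assms(3)] and h0 = module_hom_zero_minus[OF assms]
  show ?thesis
    by (rule M.submoduleI) (auto simp: h h0)
qed

lemma submodule_restrict:
  assumes "module F M" "submodule Z F M" "submodule B F M" "B \<subseteq> Z"
  shows "submodule B F (M\<lparr>carrier := Z\<rparr>)"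
proof -
  interpret M: module F M by fact
  interpret MZ: module F "M\<lparr>carrier := Z\<rparr>"
    using assms submodule.submodule_is_module by blast
  interpret MB: module F "M\<lparr>carrier := B\<rparr>"
    using assms submodule.submodule_is_module by blast
  show ?thesis
    by (rule MZ.module_incl_imp_submodule) (use assms(4) MB.module_axioms in auto)
qed

lemma submodule_abelian_subgroup:
  assumes "module F M" "submodule N F M"
  shows "abelian_subgroup N M"
  using assms
  by (intro abelian_subgroupI3) (auto simp: additive_subgroup_def submodule_def module_def)

lemma quotient_module_simps:
  "carrier (quotient_module M N) = (\<lambda>x. N +>\<^bsub>M\<^esub> x) ` carrier M"
  "\<zero>\<^bsub>quotient_module M N\<^esub> = N"
  by (auto simp: quotient_module_def A_RCOSETS_def')

lemma quotient_module_add: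
  assumes "module F M" "submodule N F M" "x \<in> carrier M" "y \<in> carrier M"
  shows "(N +>\<^bsub>M\<^esub> x) \<oplus>\<^bsub>quotient_module M N\<^esub> (N +>\<^bsub>M\<^esub> y) = N +>\<^bsub>M\<^esub> (x \<oplus>\<^bsub>M\<^esub> y)"
proof -
  interpret abelian_subgroup N M
    using assms submodule_abelian_subgroup by blast
  show ?thesis using assms(3,4) by (simp add: quotient_module_def a_rcos_sum)
qed

lemma coset_eq_const:
  assumes "abelian_subgroup N M" "x \<in> carrier M" "\<And>y. y \<in> N +>\<^bsub>M\<^esub> x \<Longrightarrow> f y = f x"
  shows "(\<Union>y\<in>N +>\<^bsub>M\<^esub> x. f y) = f x"
  using assms abelian_subgroup.a_rcos_self by fastforce

lemma module_hom_coset: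
  assumes "module F M" "module F M'" "h \<in> mod_hom F M M'" "submodule N F M" "submodule N' F M'"
    "h ` N \<subseteq> N'" "x \<in> carrier M"
  shows "(\<Union>y\<in>N +>\<^bsub>M\<^esub> x. N' +>\<^bsub>M'\<^esub> h y) = N' +>\<^bsub>M'\<^esub> h x"
proof (rule coset_eq_const)
  interpret M: module F M by fact
  interpret M': module F M' by fact
  interpret N: abelian_subgroup N M
    using assms submodule_abelian_subgroup by blast
  interpret N': abelian_subgroup N' M'
    using assms submodule_abelian_subgroup by blast
  note h = module_homD[OF assms(3)]
  show "abelian_subgroup N M" by unfold_locales
  show "x \<in> carrier M" by fact
  fix y assume "y \<in> N +>\<^bsub>M\<^esub> x"
  then obtain n where n: "n \<in> N" "y = n \<oplus>\<^bsub>M\<^esub> x"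
    by (auto simp: a_r_coset_def')
  then have "h y = h n \<oplus>\<^bsub>M'\<^esub> h x" using h(2) assms(7) N.a_subset by blast
  then have "h y \<in> N' +>\<^bsub>M'\<^esub> h x" using n assms(6) by (auto simp: a_r_coset_def')
  then show "N' +>\<^bsub>M'\<^esub> h y = N' +>\<^bsub>M'\<^esub> h x"
    using N'.a_repr_independence' h(1) assms(7) by metis
qed

lemma smult_module_hom:
  assumes "module F M" "a \<in> carrier F"
  shows "(\<lambda>x. a \<odot>\<^bsub>M\<^esub> x) \<in> mod_hom F M M"
proof -
  interpret M: module F M by fact
  show ?thesis
    using assms(2) by (intro module_homI) (auto simp: M.smult_r_distr M.R.m_comm simp flip: M.smult_assoc1)
qed

lemma quotient_module_smult:
  assumes "module F M" "submodule N F M" "a \<in> carrier F" "x \<in> carrier M"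
  shows "a \<odot>\<^bsub>quotient_module M N\<^esub> (N +>\<^bsub>M\<^esub> x) = N +>\<^bsub>M\<^esub> (a \<odot>\<^bsub>M\<^esub> x)"
  using module_hom_coset[OF assms(1,1) smult_module_hom[OF assms(1,3)] assms(2,2) _ assms(4)]
    submodule.smult_closed[OF assms(2,3)]
  by (auto simp: quotient_module_def)

lemma module_quotient_module:
  assumes "module F M" "submodule N F M"
  shows "module F (quotient_module M N)"
proof -
  interpret M: module F M by fact
  interpret N: abelian_subgroup N M
    using assms submodule_abelian_subgroup by blast
  have zero: "\<zero>\<^bsub>quotient_module M N\<^esub> = N +>\<^bsub>M\<^esub> \<zero>\<^bsub>M\<^esub>"
    using N.a_subset by (simp add: quotient_module_simps M.a_coset_add_zero)
  have "abelian_group (quotient_module M N)"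
  proof (rule abelian_groupI)
    fix A assume "A \<in> carrier (quotient_module M N)"
    then obtain x where "x \<in> carrier M" "A = N +>\<^bsub>M\<^esub> x"
      by (auto simp: quotient_module_simps)
    then show "\<exists>B\<in>carrier (quotient_module M N).
        B \<oplus>\<^bsub>quotient_module M N\<^esub> A = \<zero>\<^bsub>quotient_module M N\<^esub>"
      by (intro bexI[of _ "N +>\<^bsub>M\<^esub> (\<ominus>\<^bsub>M\<^esub> x)"])
        (auto simp: quotient_module_simps(1) quotient_module_add[OF assms] zero M.l_neg)
  qed (auto simp: quotient_module_simps(1) quotient_module_add[OF assms] zero M.a_ac)
  then show ?thesis
    by (intro moduleI)
      (auto simp: quotient_module_simps quotient_module_add[OF assms] quotient_module_smult[OF assms]
        M.smult_l_distr M.smult_r_distr M.smult_assoc1 M.R.is_cring)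
qed

lemma module_hom_quotient:
  assumes "module F M" "module F M'" "h \<in> mod_hom F M M'" "submodule N F M" "submodule N' F M'"
    "h ` N \<subseteq> N'"
  shows "(\<lambda>A. \<Union>y\<in>A. N' +>\<^bsub>M'\<^esub> h y) \<in> mod_hom F (quotient_module M N) (quotient_module M' N')"
proof -
  interpret M: module F M by fact
  note h = module_homD[OF assms(3)]
  note simps = quotient_module_simps(1) module_hom_coset[OF assms] quotient_module_add[OF assms(1,4)]
    quotient_module_add[OF assms(2,5)] quotient_module_smult[OF assms(1,4)]
    quotient_module_smult[OF assms(2,5)] h M.a_closed M.smult_closed
  show ?thesis
  proof (rule module_homI)
    fix A B assume "A \<in> carrier (quotient_module M N)" "B \<in> carrier (quotient_module M N)"
    then obtain x y where "x \<in> carrier M" "A = N +>\<^bsub>M\<^esub> x" "y \<in> carrier M" "B = N +>\<^bsub>M\<^esub> y"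
      by (auto simp: quotient_module_simps)
    then show "(\<Union>y\<in>A \<oplus>\<^bsub>quotient_module M N\<^esub> B. N' +>\<^bsub>M'\<^esub> h y) =
       (\<Union>y\<in>A. N' +>\<^bsub>M'\<^esub> h y) \<oplus>\<^bsub>quotient_module M' N'\<^esub> (\<Union>y\<in>B. N' +>\<^bsub>M'\<^esub> h y)"
      by (simp only: simps)
  next
    fix a A assume "a \<in> carrier F" "A \<in> carrier (quotient_module M N)"
    then obtain x where "a \<in> carrier F" "x \<in> carrier M" "A = N +>\<^bsub>M\<^esub> x"
      by (auto simp: quotient_module_simps)
    then show "(\<Union>y\<in>a \<odot>\<^bsub>quotient_module M N\<^esub> A. N' +>\<^bsub>M'\<^esub> h y) =
       a \<odot>\<^bsub>quotient_module M' N'\<^esub> (\<Union>y\<in>A. N' +>\<^bsub>M'\<^esub> h y)"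
      by (simp only: simps)
  qed (auto simp: simps)
qed

lemma module_direct_sum_module:
  assumes F: "cring F" and M: "\<And>i. module F (M i)"
  shows "module F (direct_sum_module M)"
proof -
  have ag: "abelian_group (M i)" and am: "abelian_monoid (M i)" for i
    using M[of i] by (simp_all add: module_def abelian_group_def)
  note M' = module.smult_closed[OF M] module.smult_l_distr[OF M] module.smult_r_distr[OF M]
    module.smult_assoc1[OF M] module.smult_one[OF M] module.smult_r_null[OF M]
  note A = abelian_monoid.a_closed[OF am] abelian_monoid.zero_closed[OF am]
    abelian_monoid.a_assoc[OF am] abelian_monoid.a_comm[OF am] abelian_monoid.l_zero[OF am]
    abelian_monoid.r_zero[OF am] abelian_monoid.a_lcomm[OF am]
  have fin_add: "finite {i. x i \<oplus>\<^bsub>M i\<^esub> y i \<noteq> \<zero>\<^bsub>M i\<^esub>}"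
    if "finite {i. x i \<noteq> \<zero>\<^bsub>M i\<^esub>}" "finite {i. y i \<noteq> \<zero>\<^bsub>M i\<^esub>}" for x y
    using that(1,2) by (intro finite_subset[OF _ finite_UnI[OF that]]) (auto simp: A)
  have fin_smult: "finite {i. a \<odot>\<^bsub>M i\<^esub> x i \<noteq> \<zero>\<^bsub>M i\<^esub>}"
    if "finite {i. x i \<noteq> \<zero>\<^bsub>M i\<^esub>}" "a \<in> carrier F" for x a
    using that by (intro finite_subset[OF _ that(1)]) (auto simp: M')
  have "abelian_group (direct_sum_module M)"
  proof (rule abelian_groupI)
    fix x assume x: "x \<in> carrier (direct_sum_module M)"
    define y where "y = (\<lambda>i. \<ominus>\<^bsub>M i\<^esub> x i)"
    have "y i \<in> carrier (M i)" "y i \<oplus>\<^bsub>M i\<^esub> x i = \<zero>\<^bsub>M i\<^esub>" for i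
      using x by (auto simp: y_def direct_sum_module_def abelian_group.a_inv_closed[OF ag]
          abelian_group.l_neg[OF ag])
    moreover have "{i. y i \<noteq> \<zero>\<^bsub>M i\<^esub>} \<subseteq> {i. x i \<noteq> \<zero>\<^bsub>M i\<^esub>}"
      by (auto simp: y_def abelian_group.minus_equality[OF ag] A)
    ultimately show "\<exists>y\<in>carrier (direct_sum_module M). y \<oplus>\<^bsub>direct_sum_module M\<^esub> x
                       = \<zero>\<^bsub>direct_sum_module M\<^esub>"
      using x by (intro bexI[of _ y]) (auto simp: direct_sum_module_def intro: finite_subset)
  qed (auto simp: direct_sum_module_def A fin_add)
  then show ?thesis
    by (intro moduleI F) (auto simp: direct_sum_module_def M' fin_smult)
qed

lemma module_hom_direct_sum:
  assumes "\<And>i. module F (M i)" "\<And>i. module F (N i)" "\<And>i. h i \<in> mod_hom F (M i) (N i)"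
  shows "(\<lambda>x i. h i (x i)) \<in> mod_hom F (direct_sum_module M) (direct_sum_module N)"
proof -
  note h = module_homD[OF assms(3)] and h0 = module_hom_zero_minus(1)[OF assms]
  have "finite {i. h i (x i) \<noteq> \<zero>\<^bsub>N i\<^esub>}" if "finite {i. x i \<noteq> \<zero>\<^bsub>M i\<^esub>}" for x
    by (rule finite_subset[OF _ that]) (use h0 in force)
  then show ?thesis
    by (intro module_homI) (auto simp: direct_sum_module_def h)
qed

lemma module_cochain_module:
  assumes "cring F"
  shows "module F (cochain_module F p X)"
proof -
  interpret F: cring F by fact
  have "abelian_group (cochain_module F p X)"
  proof (rule abelian_groupI)
    fix c assume "c \<in> carrier (cochain_module F p X)"
    then show "\<exists>d\<in>carrier (cochain_module F p X).
        d \<oplus>\<^bsub>cochain_module F p X\<^esub> c = \<zero>\<^bsub>cochain_module F p X\<^esub>"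
      by (intro bexI[of _ "\<lambda>\<sigma>\<in>singular_simplex_set p X. \<ominus>\<^bsub>F\<^esub> c \<sigma>"])
        (auto simp: cochain_module_def PiE_iff F.l_neg cong: restrict_cong)
  qed (auto simp: cochain_module_def F.a_ac PiE_iff extensional_def fun_eq_iff)
  then show ?thesis
    by (intro moduleI assms)
      (auto simp: cochain_module_def PiE_iff F.l_distr F.r_distr F.m_assoc extensional_def fun_eq_iff)
qed

lemma singular_simplex_face:
  "\<lbrakk>singular_simplex (Suc p) X \<sigma>; i \<le> Suc p\<rbrakk> \<Longrightarrow> singular_simplex p X (singular_face (Suc p) i \<sigma>)"
  using singular_simplex_singular_face[of "Suc p" X \<sigma> i] by simp

lemma coboundary_module_hom:
  assumes "cring F"
  shows "coboundary F p X \<in> mod_hom F (cochain_module F p X) (cochain_module F (Suc p) X)"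
proof -
  interpret F: cring F by fact
  note s = singular_simplex_face
  have m: "((\<ominus>\<^bsub>F\<^esub> \<one>\<^bsub>F\<^esub>) [^]\<^bsub>F\<^esub> i) \<in> carrier F" for i :: nat by simp
  have ev: "c (singular_face (Suc p) i \<sigma>) \<in> carrier F"
    if "c \<in> carrier (cochain_module F p X)" "singular_simplex (Suc p) X \<sigma>" "i \<le> Suc p" for c \<sigma> i
    using that s by (fastforce simp: cochain_module_def PiE_iff)
  show ?thesis
  proof (rule module_homI)
    fix c assume c: "c \<in> carrier (cochain_module F p X)"
    show "coboundary F p X c \<in> carrier (cochain_module F (Suc p) X)"
      using ev[OF c] by (auto simp: coboundary_def cochain_module_def simp del: F.finsum_Suc intro!: F.finsum_closed)
  next
    fix c d assume c: "c \<in> carrier (cochain_module F p X)" and d: "d \<in> carrier (cochain_module F p X)"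
    have "(\<Oplus>\<^bsub>F\<^esub>i\<in>{..Suc p}. ((\<ominus>\<^bsub>F\<^esub> \<one>\<^bsub>F\<^esub>) [^]\<^bsub>F\<^esub> i) \<otimes>\<^bsub>F\<^esub> (c \<oplus>\<^bsub>cochain_module F p X\<^esub> d) (singular_face (Suc p) i \<sigma>)) =
      (\<Oplus>\<^bsub>F\<^esub>i\<in>{..Suc p}. ((\<ominus>\<^bsub>F\<^esub> \<one>\<^bsub>F\<^esub>) [^]\<^bsub>F\<^esub> i) \<otimes>\<^bsub>F\<^esub> c (singular_face (Suc p) i \<sigma>)) \<oplus>\<^bsub>F\<^esub>
      (\<Oplus>\<^bsub>F\<^esub>i\<in>{..Suc p}. ((\<ominus>\<^bsub>F\<^esub> \<one>\<^bsub>F\<^esub>) [^]\<^bsub>F\<^esub> i) \<otimes>\<^bsub>F\<^esub> d (singular_face (Suc p) i \<sigma>))"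
      if \<sigma>: "singular_simplex (Suc p) X \<sigma>" for \<sigma>
      using ev[OF c \<sigma>] ev[OF d \<sigma>] s[OF \<sigma>]
      by (subst F.finsum_addf[symmetric])
        (auto simp del: F.finsum_Suc F.finsum_addf intro!: F.finsum_cong' simp: cochain_module_def F.r_distr)
    then show "coboundary F p X (c \<oplus>\<^bsub>cochain_module F p X\<^esub> d) =
        coboundary F p X c \<oplus>\<^bsub>cochain_module F (Suc p) X\<^esub> coboundary F p X d"
      unfolding coboundary_def by (auto simp: cochain_module_def simp del: F.finsum_Suc cong: restrict_cong)
  next
    fix a c assume a: "a \<in> carrier F" and c: "c \<in> carrier (cochain_module F p X)"
    have "(\<Oplus>\<^bsub>F\<^esub>i\<in>{..Suc p}. ((\<ominus>\<^bsub>F\<^esub> \<one>\<^bsub>F\<^esub>) [^]\<^bsub>F\<^esub> i) \<otimes>\<^bsub>F\<^esub> (a \<odot>\<^bsub>cochain_module F p X\<^esub> c) (singular_face (Suc p) i \<sigma>)) =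
      a \<otimes>\<^bsub>F\<^esub> (\<Oplus>\<^bsub>F\<^esub>i\<in>{..Suc p}. ((\<ominus>\<^bsub>F\<^esub> \<one>\<^bsub>F\<^esub>) [^]\<^bsub>F\<^esub> i) \<otimes>\<^bsub>F\<^esub> c (singular_face (Suc p) i \<sigma>))"
      if \<sigma>: "singular_simplex (Suc p) X \<sigma>" for \<sigma>
      using ev[OF c \<sigma>] s[OF \<sigma>] a
      by (subst F.finsum_rdistr)
        (auto simp del: F.finsum_Suc intro!: F.finsum_cong' simp: cochain_module_def F.m_lcomm)
    then show "coboundary F p X (a \<odot>\<^bsub>cochain_module F p X\<^esub> c) =
        a \<odot>\<^bsub>cochain_module F (Suc p) X\<^esub> coboundary F p X c"
      unfolding coboundary_def by (auto simp: cochain_module_def simp del: F.finsum_Suc cong: restrict_cong)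
  qed
qed

lemma (in abelian_group) finsum_alternating_zero:
  assumes "\<And>i j. i \<le> Suc n \<Longrightarrow> j \<le> n \<Longrightarrow> f i j \<in> carrier G"
    and "\<And>i j. i \<le> j \<Longrightarrow> j \<le> n \<Longrightarrow> f (Suc j) i = \<ominus> f i j"
  shows "(\<Oplus>i\<in>{..Suc n}. \<Oplus>j\<in>{..n}. f i j) = \<zero>"
  using assms
proof (induction n)
  case 0
  have "finsum G (\<lambda>i. \<Oplus>j\<in>{..0}. f i j) {..Suc 0} = f (Suc 0) 0 \<oplus> f 0 0"
    using 0 by (simp add: Pi_def)
  then show ?case using 0(1)[of 0 0] 0(2)[of 0 0] by (simp add: l_neg)
next
  case (Suc n)
  have c: "f i j \<in> carrier G" if "i \<le> Suc (Suc n)" "j \<le> Suc n" for i j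
    using Suc.prems(1) that by simp
  have "(\<Oplus>i\<in>{..Suc (Suc n)}. \<Oplus>j\<in>{..Suc n}. f i j)
      = (\<Oplus>j\<in>{..Suc n}. f (Suc (Suc n)) j) \<oplus> (\<Oplus>i\<in>{..Suc n}. \<Oplus>j\<in>{..Suc n}. f i j)"
    by (rule finsum_Suc) (use c in \<open>auto intro!: finsum_closed\<close>)
  also have "(\<Oplus>i\<in>{..Suc n}. \<Oplus>j\<in>{..Suc n}. f i j)
      = (\<Oplus>i\<in>{..Suc n}. f i (Suc n) \<oplus> (\<Oplus>j\<in>{..n}. f i j))"
  proof (rule finsum_cong')
    fix i assume "i \<in> {..Suc n}"
    then show "(\<Oplus>j\<in>{..Suc n}. f i j) = f i (Suc n) \<oplus> (\<Oplus>j\<in>{..n}. f i j)"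
      using c by (intro finsum_Suc) auto
  qed (use c in \<open>auto intro!: a_closed finsum_closed\<close>)
  also have "\<dots> = (\<Oplus>i\<in>{..Suc n}. f i (Suc n)) \<oplus> (\<Oplus>i\<in>{..Suc n}. \<Oplus>j\<in>{..n}. f i j)"
    by (rule finsum_addf) (use c in \<open>auto intro!: finsum_closed\<close>)
  also have "(\<Oplus>i\<in>{..Suc n}. \<Oplus>j\<in>{..n}. f i j) = \<zero>"
    using Suc.prems by (intro Suc.IH) auto
  finally have "(\<Oplus>i\<in>{..Suc (Suc n)}. \<Oplus>j\<in>{..Suc n}. f i j) =
      (\<Oplus>j\<in>{..Suc n}. f (Suc (Suc n)) j) \<oplus> (\<Oplus>i\<in>{..Suc n}. f i (Suc n))"
    using c finsum_closed[of "\<lambda>i. f i (Suc n)" "{..Suc n}"] by (simp add: Pi_def del: finsum_Suc)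
  also have "\<dots> = (\<Oplus>i\<in>{..Suc n}. f (Suc (Suc n)) i \<oplus> f i (Suc n))"
    by (rule finsum_addf[symmetric]) (use c in auto)
  also have "\<dots> = (\<Oplus>i\<in>{..Suc n}. \<zero>)"
    by (rule finsum_cong') (use c Suc.prems(2) in \<open>auto simp: l_neg\<close>)
  finally show ?case by simp
qed

lemma singular_face_face:
  assumes "singular_simplex (Suc (Suc p)) X \<sigma>" "i \<le> j" "j \<le> Suc p"
  shows "singular_face (Suc p) i (singular_face (Suc (Suc p)) (Suc j) \<sigma>) =
    singular_face (Suc p) j (singular_face (Suc (Suc p)) i \<sigma>)"
proof
  fix t
  show "singular_face (Suc p) i (singular_face (Suc (Suc p)) (Suc j) \<sigma>) t =
    singular_face (Suc p) j (singular_face (Suc (Suc p)) i \<sigma>) t"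
  proof (cases "t \<in> standard_simplex p")
    case True
    have fi: "simplical_face i t \<in> standard_simplex (Suc p)"
      using simplical_face_in_standard_simplex[of "Suc p" i t] True assms by simp
    have fj: "simplical_face j t \<in> standard_simplex (Suc p)"
      using simplical_face_in_standard_simplex[of "Suc p" j t] True assms by simp
    have eq: "simplical_face (Suc j) (simplical_face i t) = simplical_face i (simplical_face j t)"
      using assms unfolding simplical_face_def by fastforce
    show ?thesis by (simp add: singular_face_def fi fj eq)
  qed (simp add: singular_face_def)
qed

lemma coboundary_coboundary:
  assumes "cring F" "c \<in> carrier (cochain_module F p X)"
  shows "coboundary F (Suc p) X (coboundary F p X c) = \<zero>\<^bsub>cochain_module F (Suc (Suc p)) X\<^esub>"
proof -
  interpret F: cring F by fact
  let ?m = "\<lambda>i::nat. (\<ominus>\<^bsub>F\<^esub> \<one>\<^bsub>F\<^esub>) [^]\<^bsub>F\<^esub> i"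
  have "(\<Oplus>\<^bsub>F\<^esub>i\<in>{..Suc (Suc p)}. ?m i \<otimes>\<^bsub>F\<^esub> coboundary F p X c (singular_face (Suc (Suc p)) i \<sigma>)) = \<zero>\<^bsub>F\<^esub>"
    if \<sigma>: "singular_simplex (Suc (Suc p)) X \<sigma>" for \<sigma>
  proof -
    have si: "singular_simplex (Suc p) X (singular_face (Suc (Suc p)) i \<sigma>)" if "i \<le> Suc (Suc p)" for i
      using that \<sigma> singular_simplex_face by blast
    have c: "c (singular_face (Suc p) j (singular_face (Suc (Suc p)) i \<sigma>)) \<in> carrier F"
      if "i \<le> Suc (Suc p)" "j \<le> Suc p" for i j
      using assms(2) singular_simplex_face[OF si[OF that(1)] that(2)]
      by (auto simp: cochain_module_def PiE_iff)
    have "(\<Oplus>\<^bsub>F\<^esub>i\<in>{..Suc (Suc p)}. ?m i \<otimes>\<^bsub>F\<^esub> coboundary F p X c (singular_face (Suc (Suc p)) i \<sigma>)) =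
      (\<Oplus>\<^bsub>F\<^esub>i\<in>{..Suc (Suc p)}. \<Oplus>\<^bsub>F\<^esub>j\<in>{..Suc p}. ?m i \<otimes>\<^bsub>F\<^esub> (?m j \<otimes>\<^bsub>F\<^esub> c (singular_face (Suc p) j (singular_face (Suc (Suc p)) i \<sigma>))))"
      by (rule F.finsum_cong')
        (use c si in \<open>auto simp: coboundary_def F.finsum_rdistr simp del: F.finsum_Suc intro!: F.finsum_closed\<close>)
    also have "\<dots> = \<zero>\<^bsub>F\<^esub>"
    proof (rule F.finsum_alternating_zero)
      fix i j assume ij: "i \<le> j" "j \<le> Suc p"
      then show "?m (Suc j) \<otimes>\<^bsub>F\<^esub> (?m i \<otimes>\<^bsub>F\<^esub> c (singular_face (Suc p) i (singular_face (Suc (Suc p)) (Suc j) \<sigma>)))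
        = \<ominus>\<^bsub>F\<^esub> (?m i \<otimes>\<^bsub>F\<^esub> (?m j \<otimes>\<^bsub>F\<^esub> c (singular_face (Suc p) j (singular_face (Suc (Suc p)) i \<sigma>))))"
        using c[of i j] by (simp add: singular_face_face[OF \<sigma>] F.r_minus F.l_minus F.m_lcomm)
    qed (use c in auto)
    finally show ?thesis .
  qed
  then show ?thesis
    unfolding coboundary_def[of F "Suc p"] by (auto simp: cochain_module_def simp del: F.finsum_Suc cong: restrict_cong)
qed

lemma submodule_cocycles:
  assumes "cring F" shows "submodule (cocycles F p X) F (cochain_module F p X)"
  unfolding cocycles_def
  by (intro submodule_kernel module_cochain_module coboundary_module_hom assms)

lemma submodule_coboundaries:
  assumes "cring F" shows "submodule (coboundaries F p X) F (cochain_module F p X)"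
proof (cases p)
  case 0
  interpret module F "cochain_module F 0 X" by (rule module_cochain_module[OF assms])
  show ?thesis using 0 by (auto simp: coboundaries_def intro!: submoduleI)
next
  case (Suc q)
  show ?thesis
    using submodule_image[OF module_cochain_module[OF assms] module_cochain_module[OF assms]
        coboundary_module_hom[OF assms]] Suc
    by (simp add: coboundaries_def)
qed

lemma coboundaries_subset_cocycles:
  assumes "cring F" shows "coboundaries F p X \<subseteq> cocycles F p X"
proof (cases p)
  case 0
  interpret module F "cochain_module F 0 X" by (rule module_cochain_module[OF assms])
  show ?thesis
    using 0 module_hom_zero_minus(1)[OF module_cochain_module[OF assms] module_cochain_module[OF assms]
        coboundary_module_hom[OF assms]]
    by (auto simp: coboundaries_def cocycles_def)
next
  case (Suc q)
  then show ?thesis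
    using coboundary_coboundary[OF assms] module_homD(1)[OF coboundary_module_hom[OF assms]]
    by (auto simp: coboundaries_def cocycles_def)
qed

abbreviation cocycle_module where
  "cocycle_module F p X \<equiv> (cochain_module F p X)\<lparr>carrier := cocycles F p X\<rparr>"

lemma module_cocycle_module: "cring F \<Longrightarrow> module F (cocycle_module F p X)"
  by (intro submodule.submodule_is_module submodule_cocycles module_cochain_module)

lemma submodule_coboundaries': "cring F \<Longrightarrow> submodule (coboundaries F p X) F (cocycle_module F p X)"
  by (intro submodule_restrict submodule_cocycles module_cochain_module submodule_coboundaries
      coboundaries_subset_cocycles)

lemma module_cohomology_module: "cring F \<Longrightarrow> module F (cohomology_module F p X)"
  unfolding cohomology_module_def
  by (intro module_quotient_module module_cocycle_module submodule_coboundaries')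

lemma simplex_map_face:
  assumes "i \<le> Suc p"
  shows "singular_face (Suc p) i (simplex_map (Suc p) g \<sigma>) = simplex_map p g (singular_face (Suc p) i \<sigma>)"
  using simplical_face_in_standard_simplex[of "Suc p" i] assms
  by (auto simp: singular_face_def simplex_map_def fun_eq_iff)

lemma cochain_pullback_module_hom:
  assumes "cring F" "continuous_map X Y g"
  shows "cochain_pullback p X g \<in> mod_hom F (cochain_module F p Y) (cochain_module F p X)"
  using singular_simplex_simplex_map[OF _ assms(2)]
  by (intro module_homI) (auto simp: cochain_pullback_def cochain_module_def PiE_iff cong: restrict_cong)

lemma coboundary_cochain_pullback:
  assumes "cring F" "continuous_map X Y g" "c \<in> carrier (cochain_module F p Y)"
  shows "coboundary F p X (cochain_pullback p X g c) = cochain_pullback (Suc p) X g (coboundary F p Y c)"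
proof -
  interpret F: cring F by fact
  have "(\<Oplus>\<^bsub>F\<^esub>i\<in>{..Suc p}. ((\<ominus>\<^bsub>F\<^esub> \<one>\<^bsub>F\<^esub>) [^]\<^bsub>F\<^esub> i) \<otimes>\<^bsub>F\<^esub> cochain_pullback p X g c (singular_face (Suc p) i \<sigma>)) =
    coboundary F p Y c (simplex_map (Suc p) g \<sigma>)" if \<sigma>: "singular_simplex (Suc p) X \<sigma>" for \<sigma>
  proof -
    note s = singular_simplex_simplex_map[OF _ assms(2)]
    show ?thesis
      unfolding coboundary_def
      using s[OF \<sigma>] singular_simplex_face[OF \<sigma>] s[OF singular_simplex_face[OF \<sigma>]] assms(3)
      by (auto simp: cochain_pullback_def cochain_module_def PiE_iff simplex_map_face
          simp del: F.finsum_Suc intro!: F.finsum_cong')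
  qed
  then show ?thesis
    unfolding coboundary_def[of F p X] cochain_pullback_def[of "Suc p"] by (auto cong: restrict_cong)
qed

lemma cochain_pullback_cocycles:
  assumes "cring F" "continuous_map X Y g" "c \<in> cocycles F p Y"
  shows "cochain_pullback p X g c \<in> cocycles F p X"
proof -
  note z = module_hom_zero_minus(1)[OF module_cochain_module[OF assms(1)] module_cochain_module[OF assms(1)]
      cochain_pullback_module_hom[OF assms(1,2)]]
  show ?thesis
    using assms(3) coboundary_cochain_pullback[OF assms(1,2)] z
      module_homD(1)[OF cochain_pullback_module_hom[OF assms(1,2)]]
    by (auto simp: cocycles_def)
qed

lemma cochain_pullback_coboundaries:
  assumes "cring F" "continuous_map X Y g"
  shows "cochain_pullback p X g ` coboundaries F p Y \<subseteq> coboundaries F p X"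
proof (cases p)
  case 0
  show ?thesis
    using 0 module_hom_zero_minus(1)[OF module_cochain_module[OF assms(1)] module_cochain_module[OF assms(1)]
      cochain_pullback_module_hom[OF assms(1,2)]]
    by (simp add: coboundaries_def)
next
  case (Suc q)
  show ?thesis
    using module_homD(1)[OF cochain_pullback_module_hom[OF assms]]
    by (auto simp: Suc coboundaries_def simp flip: coboundary_cochain_pullback[OF assms])
qed

lemma cochain_pullback_module_hom':
  assumes "cring F" "continuous_map X Y g"
  shows "cochain_pullback p X g \<in> mod_hom F (cocycle_module F p Y) (cocycle_module F p X)"
  using module_homD[OF cochain_pullback_module_hom[OF assms]] cochain_pullback_cocycles[OF assms]
  by (intro module_homI) (auto simp: cocycles_def)

lemma coset_carrier_update: "N +>\<^bsub>M\<lparr>carrier := Z\<rparr>\<^esub> x = N +>\<^bsub>M\<^esub> x"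
  by (simp add: a_r_coset_def')

lemma cohomology_map_module_hom:
  assumes "cring F" "continuous_map X Y g"
  shows "cohomology_map F p X g \<in> mod_hom F (cohomology_module F p Y) (cohomology_module F p X)"
  using module_hom_quotient[OF module_cocycle_module[OF assms(1)] module_cocycle_module[OF assms(1)]
      cochain_pullback_module_hom'[OF assms] submodule_coboundaries'[OF assms(1)]
      submodule_coboundaries'[OF assms(1)] cochain_pullback_coboundaries[OF assms]]
  unfolding cohomology_module_def cohomology_map_def coset_carrier_update
  by (simp add: fun_eq_iff cohomology_map_def[abs_def])

lemma cohomology_map_coset:
  assumes "cring F" "continuous_map X Y g" "c \<in> cocycles F p Y"
  shows "cohomology_map F p X g (coboundaries F p Y +>\<^bsub>cochain_module F p Y\<^esub> c) =
    coboundaries F p X +>\<^bsub>cochain_module F p X\<^esub> cochain_pullback p X g c"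
  using module_hom_coset[OF module_cocycle_module[OF assms(1)] module_cocycle_module[OF assms(1)]
      cochain_pullback_module_hom'[OF assms(1,2)] submodule_coboundaries'[OF assms(1)]
      submodule_coboundaries'[OF assms(1)] cochain_pullback_coboundaries[OF assms(1,2)]] assms(3)
  by (simp add: cohomology_map_def coset_carrier_update)

lemma carrier_cohomology_module:
  "carrier (cohomology_module F p X) = (\<lambda>c. coboundaries F p X +>\<^bsub>cochain_module F p X\<^esub> c) ` cocycles F p X"
  by (simp add: cohomology_module_def quotient_module_simps coset_carrier_update)

lemma cohomology_map_id:
  assumes "cring F" "A \<in> carrier (cohomology_module F p X)" "\<And>x. x \<in> topspace X \<Longrightarrow> g x = x"
  shows "cohomology_map F p X g A = A"
proof -
  obtain c where c: "c \<in> cocycles F p X" "A = coboundaries F p X +>\<^bsub>cochain_module F p X\<^esub> c"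
    using assms(2) by (auto simp: carrier_cohomology_module)
  have "continuous_map X X g"
    by (rule continuous_map_eq[of X X id]) (auto simp: assms(3))
  moreover have "simplex_map p g \<sigma> = \<sigma>" if "singular_simplex p X \<sigma>" for \<sigma>
  proof -
    have "\<sigma> t \<in> topspace X" if "t \<in> standard_simplex p" for t
      using that \<open>singular_simplex p X \<sigma>\<close>
      by (auto simp: singular_simplex_def continuous_map_def topspace_standard_simplex Pi_iff)
    then show ?thesis
      using that by (fastforce simp: simplex_map_def singular_simplex_def assms(3) extensional_def fun_eq_iff)
  qed
  then have "cochain_pullback p X g c = restrict c (singular_simplex_set p X)"
    by (simp add: cochain_pullback_def cong: restrict_cong)
  then have "cochain_pullback p X g c = c"
    using c(1) by (auto simp: cocycles_def cochain_module_def PiE_iff extensional_restrict)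
  ultimately show ?thesis
    using c cohomology_map_coset[OF assms(1), of X X g c p] by simp
qed

lemma cohomology_map_compose:
  assumes "cring F" "A \<in> carrier (cohomology_module F p Z)"
    "continuous_map X Y g" "continuous_map Y Z h" "\<And>x. x \<in> topspace X \<Longrightarrow> k x = h (g x)"
  shows "cohomology_map F p X k A = cohomology_map F p X g (cohomology_map F p Y h A)"
proof -
  obtain c where c: "c \<in> cocycles F p Z" "A = coboundaries F p Z +>\<^bsub>cochain_module F p Z\<^esub> c"
    using assms(2) by (auto simp: carrier_cohomology_module)
  have k: "continuous_map X Z k"
    by (rule continuous_map_eq[of X Z "h \<circ> g"]) (auto simp: assms(5) intro: continuous_map_compose[OF assms(3,4)])
  have "simplex_map p k \<sigma> = simplex_map p h (simplex_map p g \<sigma>)" if "singular_simplex p X \<sigma>" for \<sigma>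
  proof -
    have "\<sigma> t \<in> topspace X" if "t \<in> standard_simplex p" for t
      using that \<open>singular_simplex p X \<sigma>\<close>
      by (auto simp: singular_simplex_def continuous_map_def topspace_standard_simplex Pi_iff)
    then show ?thesis
      by (auto simp: simplex_map_def assms(5) fun_eq_iff)
  qed
  then have "cochain_pullback p X k c = cochain_pullback p X g (cochain_pullback p Y h c)"
    using singular_simplex_simplex_map[OF _ assms(3)] by (auto simp: cochain_pullback_def cong: restrict_cong)
  then show ?thesis
    using c k assms by (simp add: cohomology_map_coset cochain_pullback_cocycles)
qed

lemma topspace_commuting_tuples:
  "topspace (commuting_tuples n) =
    {g \<in> {1..n} \<rightarrow>\<^sub>E SU2. \<forall>i\<in>{1..n}. \<forall>j\<in>{1..n}. g i ** g j = g j ** g i}"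
  by (auto simp: commuting_tuples_def)

lemma continuous_map_reindex:
  assumes "f \<in> fi_hom m n"
  shows "continuous_map (commuting_tuples n) (commuting_tuples m) (reindex m f)"
proof -
  have f: "f i \<in> {1..n}" if "i \<in> {1..m}" for i
    using assms that by (auto simp: fi_hom_def)
  have "continuous_map (commuting_tuples n) (product_topology (\<lambda>_. top_of_set SU2) {1..m}) (reindex m f)"
    unfolding commuting_tuples_def
    by (intro continuous_map_from_subtopology)
      (use f in \<open>auto simp: continuous_map_componentwise reindex_def intro!: continuous_map_product_projection\<close>)
  moreover have "reindex m f \<in> topspace (commuting_tuples n) \<rightarrow>
      {g. \<forall>i\<in>{1..m}. \<forall>j\<in>{1..m}. g i ** g j = g j ** g i}"
    using f by (auto simp: topspace_commuting_tuples reindex_def)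
  ultimately show ?thesis
    by (auto simp: commuting_tuples_def[of m] continuous_map_in_subtopology)
qed

theorem fi_module_commuting_cohomology:
  assumes "field F"
  shows "fi_module F (commuting_cohomology F) (commuting_cohomology_map F)"
proof -
  interpret F: field F by fact
  note R = F.is_cring
  note defs = commuting_cohomology_def total_cohomology_def commuting_cohomology_map_def
    total_cohomology_map_def
  show ?thesis
  proof (intro fi_module.intro fi_module_axioms.intro assms)
    show "module F (commuting_cohomology F n)" for n
      unfolding defs by (intro module_direct_sum_module module_cohomology_module R)
    show "commuting_cohomology_map F m n f \<in> mod_hom F (commuting_cohomology F m) (commuting_cohomology F n)"
      if "f \<in> fi_hom m n" for m n f
      using module_hom_direct_sum[where h = "\<lambda>p. cohomology_map F p (commuting_tuples n) (reindex m f)",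
          OF module_cohomology_module[OF R] module_cohomology_module[OF R]
          cohomology_map_module_hom[OF R continuous_map_reindex[OF that]]]
      by (simp add: defs[abs_def])
    show "commuting_cohomology_map F n n (\<lambda>i\<in>{1..n}. i) x = x" if "x \<in> carrier (commuting_cohomology F n)" for x n
      using that
      by (auto simp: defs direct_sum_module_def fun_eq_iff reindex_def topspace_commuting_tuples PiE_iff
          extensional_def intro!: cohomology_map_id[OF R])
    show "commuting_cohomology_map F l n (compose {1..l} g f) x =
        commuting_cohomology_map F m n g (commuting_cohomology_map F l m f x)"
      if "f \<in> fi_hom l m" "g \<in> fi_hom m n" "x \<in> carrier (commuting_cohomology F l)" for f g x l m n
    proof -
      have "f i \<in> {1..m}" if "i \<in> {1..l}" for i
        using \<open>f \<in> fi_hom l m\<close> that by (auto simp: fi_hom_def)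
      then have "reindex l (compose {1..l} g f) y = reindex l f (reindex m g y)" for y
        by (auto simp: reindex_def compose_def fun_eq_iff)
      then show ?thesis
        using that(3) cohomology_map_compose[OF R _ continuous_map_reindex[OF that(2)] continuous_map_reindex[OF that(1)]]
        by (auto simp: defs direct_sum_module_def fun_eq_iff)
    qed
  qed
qed

end

theory Submission
  imports Defs
begin

text \<open>
  The total cohomology is the direct sum over all degrees, and an FI-module structure map preserves
  degrees. Finitely many elements live in degrees below some bound, and the elements concentrated
  below that bound form a sub-FI-module. Finite generation would therefore give one bound for the
  degrees of all nonzero classes on all spaces of commuting tuples. So it suffices to find nonzero
  mod 2 cohomology on \<open>Hom(\<int>\<^sup>n, SU(2))\<close> in arbitrarily high degree, and there is such a
  class in degree \<open>n\<close> for every positive \<open>n\<close> divisible by \<open>4\<close>.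

  The class is detected on the fundamental cycle of the torus of diagonal tuples. On the torus, the map
  \<open>x \<mapsto> (\<Sum>(1 + Re x\<^sub>j) - 1, Im x\<^sub>1, \<dots>, Im x\<^sub>n)\<close> into punctured Euclidean space is, up
  to homotopy, the pinch map onto the sphere: the first coordinate separates \<open>(-1, \<dots>, -1)\<close> from all
  other sign vectors. That the torus cycle has odd image is shown by induction on \<open>n\<close>, cutting the
  last circle into two arcs and applying the Mayer--Vietoris boundary map
  (\<open>mayer_vietoris_even_cycle\<close>, \<open>torus_cycle_not_even\<close>).

  The point of \<open>n\<close> being divisible by \<open>4\<close> is that this map extends to all commuting tuples. The
  imaginary parts \<open>v\<^sub>j\<close> of commuting unit quaternions \<open>g\<^sub>j\<close> are real multiples of one imaginary unit
  \<open>u\<close>, determined up to sign, so \<open>(v\<^sub>1, \<dots>, v\<^sub>n)\<close> lives in \<open>n\<close> copies of the tautological line bundle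
  over the real projective plane. Four copies of that bundle are trivial: the quaternion
  \<open>v\<^sub>1 + v\<^sub>2 i + v\<^sub>3 j + v\<^sub>4 k = u (t\<^sub>1 + t\<^sub>2 i + t\<^sub>3 j + t\<^sub>4 k)\<close> vanishes only when all \<open>v\<^sub>j\<close> do
  (\<open>quaternionic_block_zero\<close>). Replacing the imaginary parts in the torus map by these quaternions gives
  the extension \<open>tuple_map\<close>.

  Integral chains suffice for all of this: a cycle whose class is not divisible by \<open>2\<close> is seen by a
  mod 2 cocycle (\<open>cohomology_residue_ring_2_nontrivial\<close>).
\<close>

section \<open>Cycles divisible by two\<close>

text \<open>
  Divisibility of the integral homology class by \<open>2\<close>. Every homomorphism preserves it, so non-divisibility
  can be pulled back along maps without knowing any homology group.
\<close>
definition even_cycle :: "nat \<Rightarrow> 'a topology \<Rightarrow> 'a chain \<Rightarrow> bool"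
  where "even_cycle p X z \<longleftrightarrow> (\<exists>a. singular_relcycle p X {} a \<and> homologous_rel p X {} z (a + a))"

lemma even_cycle_chain_map:
  assumes "even_cycle p X z" "continuous_map X Y g"
  shows "even_cycle p Y (chain_map p g z)"
proof -
  obtain a where a: "singular_relcycle p X {} a" "homologous_rel p X {} z (a + a)"
    using assms by (auto simp: even_cycle_def)
  have "singular_relcycle p Y {} (chain_map p g a)"
    using a assms(2) by (intro singular_relcycle_chain_map) auto
  moreover have "homologous_rel p Y {} (chain_map p g z) (chain_map p g a + chain_map p g a)"
    using singular_relboundary_chain_map[of p X "{}" "z - (a + a)" Y g "{}"] a(2) assms(2)
    by (auto simp: homologous_rel_def chain_map_diff chain_map_add)
  ultimately show ?thesis by (auto simp: even_cycle_def)
qed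

lemma even_cycle_diff:
  assumes "even_cycle p X z" "even_cycle p X w"
  shows "even_cycle p X (z - w)"
proof -
  obtain a b where a: "singular_relcycle p X {} a" "homologous_rel p X {} z (a + a)"
    and b: "singular_relcycle p X {} b" "homologous_rel p X {} w (b + b)"
    using assms by (auto simp: even_cycle_def)
  have "homologous_rel p X {} (z - w) ((a + a) - (b + b))"
    by (rule homologous_rel_diff) (fact a b)+
  then show ?thesis
    unfolding even_cycle_def using singular_relcycle_diff[OF a(1) b(1)]
    by (intro exI[of _ "a - b"]) (simp add: algebra_simps)
qed

lemma homologous_rel_set_hom:
  "homologous_rel_set p X S \<in> hom (relcycle_group p X S) (relative_homology_group (int p) X S)"
  using normal.r_coset_hom_Mod[OF normal_subgroup_singular_relboundary_relcycle[of p X S]]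
  by (simp add: right_coset_singular_relboundary relative_homology_group_def)

lemma homologous_rel_set_add:
  assumes "singular_relcycle p X S a" "singular_relcycle p X S b"
  shows "homologous_rel_set p X S (a + b) =
    homologous_rel_set p X S a \<otimes>\<^bsub>relative_homology_group (int p) X S\<^esub> homologous_rel_set p X S b"
  using hom_mult[OF homologous_rel_set_hom, of a p X S b] assms by simp

text \<open>
  The Mayer--Vietoris boundary sends the class of \<open>u + l\<close> to that of \<open>\<partial>u\<close>. It is a composite of homomorphisms:
  restrict to \<open>H(X, B)\<close>, where \<open>l\<close> dies, excise to \<open>H(A, A \<inter> B)\<close>, and take the boundary. So it
  preserves divisibility by \<open>2\<close>.
\<close>
lemma mayer_vietoris_even_cycle:
  assumes A: "openin X A" and B: "openin X B" and AB: "A \<union> B = topspace X"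
    and u: "singular_chain (Suc p) (subtopology X A) u"
    and l: "singular_chain (Suc p) (subtopology X B) l"
    and cyc: "chain_boundary (Suc p) (u + l) = 0"
    and ev: "even_cycle (Suc p) X (u + l)"
  shows "even_cycle p (subtopology X (A \<inter> B)) (chain_boundary (Suc p) u)"
proof -
  let ?q = "Suc p" and ?XA = "subtopology X A"
  let ?HB = "relative_homology_group (int ?q) X B"
  let ?HA = "relative_homology_group (int ?q) ?XA (A \<inter> B)"
  obtain a where a: "singular_relcycle ?q X {} a" and ula: "homologous_rel ?q X {} (u + l) (a + a)"
    using ev by (auto simp: even_cycle_def)
  have uX: "singular_chain ?q X u" and lX: "singular_chain ?q X l"
    using u l singular_chain_subtopology by blast+
  have bul: "chain_boundary ?q u = - chain_boundary ?q l"
    using cyc by (simp add: chain_boundary_add eq_neg_iff_add_eq_0)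
  have buA: "singular_chain p ?XA (chain_boundary ?q u)" using u singular_chain_boundary_alt by blast
  have buB: "singular_chain p (subtopology X B) (chain_boundary ?q u)"
    using l singular_chain_boundary_alt bul by (metis singular_chain_minus)
  have bu: "singular_chain p (subtopology X (A \<inter> B)) (chain_boundary ?q u)"
    using buA buB by (auto simp: singular_chain_subtopology)
  have u_rel: "singular_relcycle ?q ?XA (A \<inter> B) u"
    using u bu by (simp add: singular_relcycle subtopology_subtopology Int_assoc[symmetric])
  have u_relX: "singular_relcycle ?q X B u" using uX buB by (simp add: singular_relcycle)
  have a_relX: "singular_relcycle ?q X B a" using a by (simp add: singular_cycle) (simp add: singular_relcycle)
  have "singular_relboundary ?q X B (u + l - (a + a))"
    using ula unfolding homologous_rel_def singular_boundary
    by (auto simp: singular_relboundary intro: exI[of _ 0])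
  moreover have "singular_relboundary ?q X B l" using l by (rule singular_chain_imp_relboundary)
  ultimately have "singular_relboundary ?q X B ((u + l - (a + a)) - l)" by (rule singular_relboundary_diff)
  then have "homologous_rel ?q X B u (a + a)" by (simp add: homologous_rel_def algebra_simps)
  then have class_u: "homologous_rel_set ?q X B u = homologous_rel_set ?q X B a \<otimes>\<^bsub>?HB\<^esub> homologous_rel_set ?q X B a"
    using homologous_rel_set_add[OF a_relX a_relX] homologous_rel_set_eq by metis
  \<comment> \<open>Excise the complement of \<open>A\<close>, which is closed and lies in the open set \<open>B\<close>.\<close>
  define e where "e = hom_induced (int ?q) ?XA (A \<inter> B) X B id"
  have e: "e \<in> iso ?HA ?HB"
  proof -
    have "X closure_of (topspace X - A) \<subseteq> X interior_of B"
    proof -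
      have "X closure_of (topspace X - A) = topspace X - A"
        using A by (intro closure_of_closedin) blast
      then show ?thesis using AB interior_of_openin[OF B] by auto
    qed
    moreover have "topspace X - (topspace X - A) = A" "B - (topspace X - A) = A \<inter> B"
      using openin_subset[OF A] openin_subset[OF B] by auto
    ultimately show ?thesis
      using homology_excision_axiom[of X "topspace X - A" B "topspace X" "int ?q"] openin_subset[OF B]
      by (simp add: e_def)
  qed
  have eu: "e (homologous_rel_set ?q ?XA (A \<inter> B) u) = homologous_rel_set ?q X B u"
    unfolding e_def
    by (subst hom_induced_chain_map)
      (use u_rel u in \<open>auto simp: chain_map_ident continuous_map_from_subtopology\<close>)
  obtain c where c: "c \<in> carrier ?HA" and ec: "e c = homologous_rel_set ?q X B a"
  proof -
    have "homologous_rel_set ?q X B a \<in> carrier ?HB"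
      unfolding carrier_relative_homology_group using a_relX by blast
    moreover have "e ` carrier ?HA = carrier ?HB" using e by (simp add: iso_def bij_betw_def)
    ultimately have "homologous_rel_set ?q X B a \<in> e ` carrier ?HA" by (simp only:)
    then show ?thesis by (elim imageE) (rule that, simp_all only:)
  qed
  have uA: "homologous_rel_set ?q ?XA (A \<inter> B) u \<in> carrier ?HA"
    unfolding carrier_relative_homology_group using u_rel by blast
  have cc: "c \<otimes>\<^bsub>?HA\<^esub> c \<in> carrier ?HA"
    using c by (simp add: group.is_monoid monoid.m_closed)
  have "e (c \<otimes>\<^bsub>?HA\<^esub> c) = e (homologous_rel_set ?q ?XA (A \<inter> B) u)"
    using e c hom_mult[of e ?HA ?HB c c] by (simp add: iso_def eu class_u ec)
  then have uc: "homologous_rel_set ?q ?XA (A \<inter> B) u = c \<otimes>\<^bsub>?HA\<^esub> c"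
    using e uA cc by (auto simp: iso_def bij_betw_def inj_on_def)
  obtain d where d: "singular_relcycle ?q ?XA (A \<inter> B) d" and cd: "c = homologous_rel_set ?q ?XA (A \<inter> B) d"
    using c unfolding carrier_relative_homology_group by blast
  have "homologous_rel_set ?q ?XA (A \<inter> B) u = homologous_rel_set ?q ?XA (A \<inter> B) (d + d)"
    unfolding uc cd by (rule homologous_rel_set_add[symmetric]) (fact d)+
  moreover have "singular_relcycle ?q ?XA (A \<inter> B) (d + d)" using d by (intro singular_relcycle_add)
  ultimately have "homologous_rel_set p (subtopology ?XA (A \<inter> B)) {} (chain_boundary ?q u) =
    homologous_rel_set p (subtopology ?XA (A \<inter> B)) {} (chain_boundary ?q (d + d))"
    using hom_boundary_chain_boundary[OF u_rel] hom_boundary_chain_boundary[of ?q ?XA "A \<inter> B" "d + d"] by simp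
  then have "homologous_rel p (subtopology X (A \<inter> B)) {} (chain_boundary ?q u) (chain_boundary ?q d + chain_boundary ?q d)"
    by (simp add: homologous_rel_set_eq subtopology_subtopology chain_boundary_add Int_assoc[symmetric])
  moreover have "singular_relcycle p (subtopology X (A \<inter> B)) {} (chain_boundary ?q d)"
    using d by (auto simp: singular_cycle singular_relcycle subtopology_subtopology Int_assoc[symmetric]
        chain_boundary_boundary_alt)
  ultimately show ?thesis by (auto simp: even_cycle_def)
qed

section \<open>The fundamental cycle of the torus\<close>

definition torus :: "nat \<Rightarrow> (nat \<Rightarrow> complex) topology"
  where "torus k = product_topology (\<lambda>_. top_of_set (sphere 0 1)) {1..k}"

text \<open>
  Coordinates beyond \<open>k\<close> are unconstrained, so that this is homotopy equivalent to the \<open>k\<close>-sphere and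
  the intersection of the two half spaces in \<open>punctured_space (Suc k)\<close> is literally
  \<open>punctured_space k\<close>.
\<close>
definition punctured_space :: "nat \<Rightarrow> (nat \<Rightarrow> real) topology"
  where "punctured_space k = subtopology (powertop_real UNIV) {x. \<exists>i\<le>k. x i \<noteq> 0}"

text \<open>
  For \<open>s = -1\<close> this is the pinch map of the torus onto the sphere, up to homotopy. For \<open>s = 1\<close> its first
  coordinate is positive, so it is null-homotopic; subtracting it makes the induction work uniformly
  from dimension zero, where it plays the part of reduced homology.
\<close>
definition torus_map :: "real \<Rightarrow> nat \<Rightarrow> (nat \<Rightarrow> complex) \<Rightarrow> nat \<Rightarrow> real"
  where "torus_map s k x =
    (\<lambda>i. if i = 0 then (\<Sum>j\<in>{1..k}. 1 + Re (x j)) + s else if i \<le> k then Im (x i) else 0)"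

lemma topspace_torus: "topspace (torus k) = {1..k} \<rightarrow>\<^sub>E sphere 0 1"
  by (simp add: torus_def)

lemma topspace_punctured_space: "topspace (punctured_space k) = {x. \<exists>i\<le>k. x i \<noteq> 0}"
  by (simp add: punctured_space_def)

text \<open>
  The parity argument that keeps the maps below away from the origin: where all imaginary parts vanish,
  every summand \<open>1 + Re\<close> is \<open>0\<close> or \<open>2\<close>.
\<close>
lemma sum_zero_two_odd_shift:
  fixes f :: "'a \<Rightarrow> real"
  assumes "\<And>j. j \<in> A \<Longrightarrow> f j = 0 \<or> f j = 2" "s = 1 \<or> s = -1"
  shows "sum f A + s \<noteq> 0"
proof -
  have "\<exists>m::int. sum f A = of_int (2 * m)"
    using assms(1)
  proof (induction A rule: infinite_finite_induct)
    case (insert x A)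
    then obtain m :: int where m: "sum f A = of_int (2 * m)" by auto
    show ?case using insert.prems[of x] insert.hyps m
      by (auto intro: exI[of _ m] exI[of _ "m + 1"])
  qed (auto intro: exI[of _ 0])
  then obtain m :: int where m: "sum f A = of_int (2 * m)" by blast
  have "2 * m + 1 \<noteq> 0" "2 * m + -1 \<noteq> 0" by presburger+
  then have "real_of_int (2 * m + 1) \<noteq> 0" "real_of_int (2 * m + -1) \<noteq> 0"
    by (simp_all only: of_int_eq_0_iff not_False_eq_True)
  then show ?thesis using assms(2) m by auto
qed

lemma continuous_map_torus_coordinate:
  assumes "j \<in> {1..k}" "continuous_on UNIV g"
  shows "continuous_map (torus k) euclidean (\<lambda>x. g (x j))"
proof -
  have "continuous_map (torus k) (top_of_set (sphere 0 1)) (\<lambda>x. x j)"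
    unfolding torus_def by (rule continuous_map_product_projection) (fact assms)
  moreover have "continuous_map (top_of_set (sphere 0 1)) euclidean g"
    using assms(2) continuous_on_subset by auto
  ultimately show ?thesis
    using continuous_map_compose[of "torus k" _ "\<lambda>x. x j" euclidean g] by (simp add: o_def)
qed

lemma continuous_map_torus_map:
  assumes s: "s = 1 \<or> s = -1"
  shows "continuous_map (torus k) (punctured_space k) (torus_map s k)"
  unfolding punctured_space_def continuous_map_in_subtopology
proof
  have "continuous_map (torus k) euclideanreal (\<lambda>x. torus_map s k x i)" for i
    by (auto simp: torus_map_def intro!: continuous_map_add continuous_map_sum continuous_map_torus_coordinate continuous_intros)
  then show "continuous_map (torus k) (powertop_real UNIV) (torus_map s k)"
    by (simp add: continuous_map_componentwise_UNIV)
  have "\<exists>i\<le>k. torus_map s k x i \<noteq> 0" if x: "x \<in> topspace (torus k)" for x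
  proof (rule ccontr)
    assume "\<not> ?thesis"
    then have 0: "torus_map s k x i = 0" if "i \<le> k" for i using that by auto
    have "1 + Re (x j) = 0 \<or> 1 + Re (x j) = 2" if j: "j \<in> {1..k}" for j
    proof -
      have "norm (x j) = 1" using x j by (auto simp: topspace_torus PiE_iff)
      moreover have "Im (x j) = 0" using 0[of j] j by (simp add: torus_map_def)
      ultimately have "\<bar>Re (x j)\<bar> = 1" by (simp add: cmod_def)
      then show ?thesis by linarith
    qed
    then have "(\<Sum>j\<in>{1..k}. 1 + Re (x j)) + s \<noteq> 0" by (rule sum_zero_two_odd_shift) (use s in auto)
    then show False using 0[of 0] by (simp add: torus_map_def)
  qed
  then show "torus_map s k \<in> topspace (torus k) \<rightarrow> {x. \<exists>i\<le>k. x i \<noteq> 0}" by auto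
qed

text \<open>
  The two end points of each half circle carry exactly the two maps of one dimension lower. This is what
  drives the induction, and is why the shift is by \<open>1\<close> in both directions.
\<close>
lemma torus_map_extend:
  "torus_map (-1) (Suc k) (x(Suc k := -1)) = torus_map (-1) k x"
  "torus_map (-1) (Suc k) (x(Suc k := 1)) = torus_map 1 k x"
  by (auto simp: torus_map_def fun_eq_iff)

text \<open>
  Sweeping a cycle along the upper (\<open>\<sigma> = 1\<close>) or lower (\<open>\<sigma> = -1\<close>) half of the new circle is a homotopy
  inside that half, which yields a chain bounding the difference of the end copies.
\<close>
lemma fill_arc:
  assumes z: "singular_relcycle p (torus k) {} z" and \<sigma>: "\<sigma> = 1 \<or> \<sigma> = -1"
  obtains d where "singular_chain (Suc p) (subtopology (torus (Suc k)) {x. 0 \<le> \<sigma> * Im (x (Suc k))}) d"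
    "chain_boundary (Suc p) d = chain_map p (\<lambda>x. x(Suc k := -1)) z - chain_map p (\<lambda>x. x(Suc k := 1)) z"
proof -
  let ?U = "subtopology (torus (Suc k)) {x. 0 \<le> \<sigma> * Im (x (Suc k))}"
  let ?h = "\<lambda>(t::real, x). x(Suc k := cis (\<sigma> * pi * t))"
  let ?D = "prod_topology (top_of_set {0..1::real}) (torus k)"
  have "homotopic_with (\<lambda>h. h \<in> {} \<rightarrow> {}) (torus k) ?U (\<lambda>x. x(Suc k := 1)) (\<lambda>x. x(Suc k := -1))"
    unfolding homotopic_with_def
  proof (intro exI[of _ ?h] conjI allI ballI)
    have "continuous_map ?D (torus (Suc k)) ?h"
      unfolding torus_def[of "Suc k"] continuous_map_componentwise
    proof (intro conjI ballI)
      show "?h ` topspace ?D \<subseteq> extensional {1..Suc k}"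
        by (auto simp: topspace_torus PiE_iff extensional_def)
      fix i assume i: "i \<in> {1..Suc k}"
      show "continuous_map ?D (top_of_set (sphere 0 1)) (\<lambda>x. ?h x i)"
      proof (cases "i = Suc k")
        case True
        have "continuous_map (top_of_set {0..1}) (top_of_set (sphere 0 1)) (\<lambda>t. cis (\<sigma> * pi * t))"
          by (auto simp: continuous_on_cis intro!: continuous_intros)
        then show ?thesis
          using continuous_map_of_fst[of "top_of_set {0..1}" "torus k" "top_of_set (sphere 0 1)" "\<lambda>t. cis (\<sigma> * pi * t)"] True
          by (simp add: o_def case_prod_unfold)
      next
        case False
        then have "i \<in> {1..k}" using i by auto
        then have "continuous_map (torus k) (top_of_set (sphere 0 1)) (\<lambda>x. x i)"
          unfolding torus_def by (rule continuous_map_product_projection)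
        then show ?thesis
          using continuous_map_of_snd[of "top_of_set {0..1::real}" "torus k" "top_of_set (sphere 0 1)" "\<lambda>x. x i"] False
          by (simp add: o_def case_prod_unfold)
      qed
    qed
    moreover have "?h \<in> topspace ?D \<rightarrow> {x. 0 \<le> \<sigma> * Im (x (Suc k))}"
    proof -
      have "0 \<le> sin (pi * t)" if "0 \<le> t" "t \<le> 1" for t
        using that by (intro sin_ge_zero) (auto simp: mult_le_cancel_left1)
      then show ?thesis using \<sigma> by auto
    qed
    ultimately show "continuous_map ?D ?U ?h" by (auto simp: continuous_map_in_subtopology)
    show "?h (0, x) = x(Suc k := 1)" for x by simp
    show "?h (1, x) = x(Suc k := -1)" for x using \<sigma> by (auto simp: complex_eq_iff fun_eq_iff)
  qed auto
  then have "homologous_rel p ?U {} (chain_map p (\<lambda>x. x(Suc k := -1)) z) (chain_map p (\<lambda>x. x(Suc k := 1)) z)"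
    using homotopic_imp_homologous_rel_chain_maps z homologous_rel_sym by metis
  then show ?thesis using that by (auto simp: homologous_rel_def singular_boundary)
qed

text \<open>
  In dimension zero the two image points lie in different components of the punctured line. Counting the
  points on the positive side kills boundaries, and on the difference of the two points it gives \<open>-1\<close>,
  an odd number.
\<close>
lemma zero_cycle_not_even:
  defines "z \<equiv> frag_of (\<lambda>t\<in>standard_simplex 0. (\<lambda>_. undefined) :: nat \<Rightarrow> complex)"
  shows "singular_relcycle 0 (torus 0) {} z"
    and "\<not> even_cycle 0 (punctured_space 0) (chain_map 0 (torus_map (-1) 0) z - chain_map 0 (torus_map 1 0) z)"
proof -
  show z: "singular_relcycle 0 (torus 0) {} z"
    by (auto simp: z_def singular_cycle singular_chain_of singular_simplex_def chain_boundary_def topspace_torus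
        intro: continuous_map_eq[of _ _ "\<lambda>_. \<lambda>_. undefined"])
  define v :: "nat \<Rightarrow> real" where "v = (\<lambda>j. if j = 0 then 1 else 0)"
  have v: "v \<in> standard_simplex 0" by (simp add: v_def standard_simplex_0)
  define \<phi> where "\<phi> = (\<lambda>x :: (nat \<Rightarrow> real) chain. Poly_Mapping.lookup (frag_extend (\<lambda>\<sigma>. if 0 < \<sigma> v (0::nat) then frag_of () else 0) x) () :: int)"
  have \<phi>_diff: "\<phi> (x - y) = \<phi> x - \<phi> y" for x y by (simp add: \<phi>_def frag_extend_diff lookup_minus)
  have \<phi>_add: "\<phi> (x + y) = \<phi> x + \<phi> y" for x y by (simp add: \<phi>_def frag_extend_add lookup_add)
  have \<phi>_of: "\<phi> (frag_of \<sigma>) = (if 0 < \<sigma> v 0 then 1 else 0)" for \<sigma> by (simp add: \<phi>_def)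
  have bd: "\<phi> (chain_boundary (Suc 0) b) = 0" if "singular_chain (Suc 0) (punctured_space 0) b" for b
    using that[unfolded singular_chain_def]
  proof (induction b rule: frag_induction)
    case (one \<tau>)
    then have \<tau>: "singular_simplex (Suc 0) (punctured_space 0) \<tau>" by simp
    let ?S = "standard_simplex (Suc 0)"
    have cm: "continuous_map (subtopology (powertop_real UNIV) ?S) (punctured_space 0) \<tau>"
      using \<tau> by (simp add: singular_simplex_def)
    have "continuous_map (subtopology (powertop_real UNIV) ?S) euclideanreal ((\<lambda>x. x 0) \<circ> \<tau>)"
      by (rule continuous_map_compose[OF cm])
        (auto simp: punctured_space_def intro: continuous_map_from_subtopology continuous_map_product_projection)
    then have "connectedin euclideanreal (((\<lambda>x. x 0) \<circ> \<tau>) ` ?S)"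
      by (rule connectedin_continuous_map_image) (simp add: connectedin_subtopology connectedin_standard_simplex)
    then have conn: "connected ((\<lambda>t. \<tau> t 0) ` ?S)" by (simp add: o_def)
    have nz: "\<tau> t 0 \<noteq> 0" if "t \<in> ?S" for t
      using cm that by (auto simp: continuous_map_def topspace_punctured_space topspace_standard_simplex Pi_iff)
    have less: "\<not> (\<tau> s 0 \<le> 0 \<and> 0 < \<tau> t 0)" if "s \<in> ?S" "t \<in> ?S" for s t
      using connectedD_interval[OF conn, of "\<tau> s 0" "\<tau> t 0" 0] that nz by auto
    have "simplical_face i v \<in> ?S" if "i \<le> 1" for i
      using simplical_face_in_standard_simplex[of "Suc 0" i v] that v by simp
    then have "0 < \<tau> (simplical_face 0 v) 0 \<longleftrightarrow> 0 < \<tau> (simplical_face (Suc 0) v) 0"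
      using less[of "simplical_face 0 v" "simplical_face (Suc 0) v"] less[of "simplical_face (Suc 0) v" "simplical_face 0 v"]
      by auto
    then show ?case
      using v by (simp add: chain_boundary_of \<phi>_of \<phi>_add singular_face_def flip: diff_conv_add_uminus) (simp add: \<phi>_diff \<phi>_of)
  qed (simp_all add: chain_boundary_diff \<phi>_diff, simp add: \<phi>_def)
  show "\<not> even_cycle 0 (punctured_space 0) (chain_map 0 (torus_map (-1) 0) z - chain_map 0 (torus_map 1 0) z)"
  proof
    assume "even_cycle 0 (punctured_space 0) (chain_map 0 (torus_map (-1) 0) z - chain_map 0 (torus_map 1 0) z)"
    then obtain a b where b: "singular_chain (Suc 0) (punctured_space 0) b"
      and "chain_boundary (Suc 0) b = chain_map 0 (torus_map (-1) 0) z - chain_map 0 (torus_map 1 0) z - (a + a)"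
      by (auto simp: even_cycle_def homologous_rel_def singular_boundary)
    then have "\<phi> (chain_map 0 (torus_map (-1) 0) z) - \<phi> (chain_map 0 (torus_map 1 0) z) - (\<phi> a + \<phi> a) = 0"
      using bd[OF b] by (simp add: \<phi>_diff \<phi>_add)
    moreover have "\<phi> (chain_map 0 (torus_map (-1) 0) z) = 0" "\<phi> (chain_map 0 (torus_map 1 0) z) = 1"
      using v by (simp_all add: z_def \<phi>_of simplex_map_def torus_map_def)
    ultimately have "-1 - (\<phi> a + \<phi> a) = 0" by simp
    moreover have "-1 - (m + m) \<noteq> 0" for m :: int by presburger
    ultimately show False by blast
  qed
qed

text \<open>
  The two arc fillings differ by a cycle of the bigger torus. Its image is the sum of a chain in the upper
  and a chain in the lower half space, and the boundary of the upper part is the lower-dimensional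
  difference cycle, so Mayer--Vietoris reduces oddness to the previous dimension.
\<close>
lemma torus_cycle_not_even:
  "\<exists>z. singular_relcycle k (torus k) {} z \<and>
     \<not> even_cycle k (punctured_space k) (chain_map k (torus_map (-1) k) z - chain_map k (torus_map 1 k) z)"
proof (induction k)
  case 0
  then show ?case using zero_cycle_not_even by blast
next
  case (Suc k)
  then obtain z where z: "singular_relcycle k (torus k) {} z"
    and odd: "\<not> even_cycle k (punctured_space k) (chain_map k (torus_map (-1) k) z - chain_map k (torus_map 1 k) z)"
    by blast
  let ?q = "Suc k" and ?P = "punctured_space (Suc k)"
  let ?G = "torus_map (-1) (Suc k)" and ?E = "torus_map 1 (Suc k)"
  let ?H = "\<lambda>\<sigma>. subtopology (torus ?q) {x. 0 \<le> \<sigma> * Im (x ?q)}"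
  obtain d1 where d1: "singular_chain ?q (?H 1) d1"
    and bd1: "chain_boundary ?q d1 = chain_map k (\<lambda>x. x(?q := -1)) z - chain_map k (\<lambda>x. x(?q := 1)) z"
    using fill_arc[OF z, of 1] by auto
  obtain d2 where d2: "singular_chain ?q (?H (-1)) d2"
    and bd2: "chain_boundary ?q d2 = chain_map k (\<lambda>x. x(?q := -1)) z - chain_map k (\<lambda>x. x(?q := 1)) z"
    using fill_arc[OF z, of "-1"] by auto
  have d12: "singular_chain ?q (torus ?q) d1" "singular_chain ?q (torus ?q) d2"
    using d1 d2 singular_chain_subtopology by blast+
  define w where "w = d1 - d2"
  have w: "singular_relcycle ?q (torus ?q) {} w"
    using d12 by (simp add: w_def singular_cycle singular_chain_diff chain_boundary_diff bd1 bd2)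
  define half where "half = (\<lambda>\<sigma>::real. {x. (\<exists>i\<le>k. x i \<noteq> 0) \<or> 0 < \<sigma> * x ?q})"
  have up: "\<exists>i\<le>?q. x i \<noteq> 0" if "\<exists>i\<le>k. x i \<noteq> 0" for x :: "nat \<Rightarrow> real"
    using that le_SucI by blast
  have half_open: "openin ?P (half \<sigma>)" if "\<sigma> = 1 \<or> \<sigma> = -1" for \<sigma>
  proof -
    have pr: "openin (powertop_real UNIV) {x. x i \<in> V}" if "open V" for i :: nat and V
    proof -
      have "continuous_map (powertop_real UNIV) euclideanreal (\<lambda>x. x i)"
        by (rule continuous_map_product_projection) simp
      then show ?thesis
        using openin_continuous_map_preimage[of "powertop_real UNIV" euclideanreal "\<lambda>x. x i" V] that by simp
    qed
    have eq: "half \<sigma> = (\<Union>i\<in>{..k}. {x. x i \<in> - {0}}) \<union> {x. x ?q \<in> {y. 0 < \<sigma> * y}}"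
      by (auto simp: half_def)
    have "open {y. 0 < \<sigma> * y}" by (intro open_Collect_less continuous_intros)
    then have "openin (powertop_real UNIV) {x. x ?q \<in> {y. 0 < \<sigma> * y}}" by (rule pr)
    moreover have "openin (powertop_real UNIV) (\<Union>i\<in>{..k}. {x. x i \<in> - {0}})"
      using pr[of "- {0}"] by (intro openin_Union) auto
    ultimately have "openin (powertop_real UNIV) (half \<sigma>)" unfolding eq by (intro openin_Un)
    moreover have "half \<sigma> \<subseteq> {x. \<exists>i\<le>?q. x i \<noteq> 0}" using up by (auto simp: half_def)
    ultimately show ?thesis
      unfolding punctured_space_def openin_subtopology by blast
  qed
  have cover: "half 1 \<union> half (-1) = topspace ?P"
  proof -
    have "x ?q \<noteq> 0" if "\<not> (\<exists>i\<le>k. x i \<noteq> 0)" "i \<le> ?q" "x i \<noteq> 0" for x :: "nat \<Rightarrow> real" and i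
      using that by (cases "i = ?q") auto
    then show ?thesis using up by (fastforce simp: half_def topspace_punctured_space)
  qed
  have "half 1 \<inter> half (-1) = {x. \<exists>i\<le>k. x i \<noteq> 0}" by (auto simp: half_def)
  moreover have "{x. \<exists>i\<le>?q. x i \<noteq> 0} \<inter> {x. \<exists>i\<le>k. x i \<noteq> 0} = {x::nat \<Rightarrow> real. \<exists>i\<le>k. x i \<noteq> 0}"
    using up by blast
  ultimately have inter: "subtopology ?P (half 1 \<inter> half (-1)) = punctured_space k"
    by (simp add: punctured_space_def subtopology_subtopology)
  have G: "continuous_map (torus ?q) ?P ?G" and E: "continuous_map (torus ?q) ?P ?E"
    by (rule continuous_map_torus_map; simp)+
  have G_half: "continuous_map (?H \<sigma>) (subtopology ?P (half \<sigma>)) ?G" if \<sigma>: "\<sigma> = 1 \<or> \<sigma> = -1" for \<sigma>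
  proof -
    have "?G x \<in> half \<sigma>" if x: "x \<in> topspace (torus ?q)" "0 \<le> \<sigma> * Im (x ?q)" for x
    proof -
      have "?G x \<in> topspace ?P" using G x(1) by (auto simp: continuous_map_def)
      then obtain i where i: "i \<le> ?q" "?G x i \<noteq> 0" by (auto simp: topspace_punctured_space)
      show ?thesis
      proof (cases "i = ?q")
        case True
        then have "\<sigma> * Im (x ?q) \<noteq> 0" using i \<sigma> by (auto simp: torus_map_def)
        then have "0 < \<sigma> * Im (x ?q)" using x(2) unfolding less_le by metis
        then have "0 < \<sigma> * ?G x ?q" by (simp add: torus_map_def)
        then show ?thesis by (simp add: half_def)
      next
        case False
        then have "i \<le> k" using i(1) by simp
        then show ?thesis using i(2) unfolding half_def by blast
      qed
    qed
    then show ?thesis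
      unfolding continuous_map_in_subtopology
      by (intro conjI continuous_map_from_subtopology G) auto
  qed
  have E_half: "continuous_map (torus ?q) (subtopology ?P (half (-1))) ?E"
  proof -
    have "?E x \<in> half (-1)" if x: "x \<in> topspace (torus ?q)" for x
    proof -
      have "0 \<le> 1 + Re (x j)" if "j \<in> {1..?q}" for j
        using abs_Re_le_cmod[of "x j"] x that by (auto simp: topspace_torus PiE_iff)
      then have "0 \<le> (\<Sum>j\<in>{1..?q}. 1 + Re (x j))" by (rule sum_nonneg)
      then have "0 < ?E x 0" unfolding torus_map_def by simp
      then have "\<exists>i\<le>k. ?E x i \<noteq> 0" by (metis less_irrefl zero_le)
      then show ?thesis by (simp add: half_def)
    qed
    then show ?thesis
      unfolding continuous_map_in_subtopology by (intro conjI E) auto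
  qed
  \<comment> \<open>The image of \<open>?E\<close> lies in both halves; it is put into the lower summand so that \<open>\<partial>u\<close> involves \<open>?G\<close> only.\<close>
  define u where "u = chain_map ?q ?G d1"
  define l where "l = - chain_map ?q ?G d2 - chain_map ?q ?E w"
  have ul: "u + l = chain_map ?q ?G w - chain_map ?q ?E w"
    by (simp add: u_def l_def w_def chain_map_diff)
  have u: "singular_chain ?q (subtopology ?P (half 1)) u"
    unfolding u_def by (rule singular_chain_chain_map[OF d1 G_half]) simp
  have l: "singular_chain ?q (subtopology ?P (half (-1))) l"
    unfolding l_def
    by (intro singular_chain_diff singular_chain_minus[THEN iffD2] singular_chain_chain_map[OF d2 G_half]
        singular_chain_chain_map[OF _ E_half]) (use w in \<open>auto simp: singular_cycle\<close>)
  have cyc: "chain_boundary ?q (u + l) = 0"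
  proof -
    have "singular_chain ?q (torus ?q) w" "chain_boundary ?q w = 0" using w by (simp_all add: singular_cycle)
    then show ?thesis
      unfolding ul chain_boundary_diff by (simp only: chain_boundary_chain_map chain_map_0 diff_self)
  qed
  have "chain_boundary ?q u = chain_map k ?G (chain_boundary ?q d1)"
    using d12 by (simp add: u_def chain_boundary_chain_map)
  also have "\<dots> = chain_map k (?G \<circ> (\<lambda>x. x(?q := -1))) z - chain_map k (?G \<circ> (\<lambda>x. x(?q := 1))) z"
    by (simp only: bd1 chain_map_diff chain_map_compose o_apply)
  also have "\<dots> = chain_map k (torus_map (-1) k) z - chain_map k (torus_map 1 k) z"
    by (simp add: o_def torus_map_extend)
  finally have bu: "chain_boundary ?q u = chain_map k (torus_map (-1) k) z - chain_map k (torus_map 1 k) z" .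
  have "\<not> even_cycle ?q ?P (chain_map ?q ?G w - chain_map ?q ?E w)"
  proof
    assume "even_cycle ?q ?P (chain_map ?q ?G w - chain_map ?q ?E w)"
    then have "even_cycle k (subtopology ?P (half 1 \<inter> half (-1))) (chain_boundary ?q u)"
      using mayer_vietoris_even_cycle[OF half_open half_open cover u l cyc] ul by simp
    then show False using odd by (simp add: inter bu)
  qed
  then show ?case using w by blast
qed

section \<open>Extending the pinch map to commuting tuples\<close>

text \<open>
  An element of \<open>SU(2)\<close> is the unit quaternion with real part \<open>Re a\<close> and imaginary part
  \<open>(Im a, Re b, Im b)\<close>, where \<open>(a, b)\<close> is the first row.
\<close>
lemma SU2_entries:
  assumes "A \<in> SU2"
  shows "A $ 2 $ 2 = cnj (A $ 1 $ 1)" "A $ 2 $ 1 = - cnj (A $ 1 $ 2)"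
    "(cmod (A $ 1 $ 1))\<^sup>2 + (cmod (A $ 1 $ 2))\<^sup>2 = 1"
proof -
  let ?a = "A $ 1 $ 1" and ?b = "A $ 1 $ 2" and ?c = "A $ 2 $ 1" and ?d = "A $ 2 $ 2"
  have unitary: "(A ** (\<chi> i j. cnj (A $ j $ i))) $ i $ j = mat 1 $ i $ j" for i j
    using assms by (simp add: SU2_def)
  have e11: "?a * cnj ?a + ?b * cnj ?b = 1" and e21: "?c * cnj ?a + ?d * cnj ?b = 0"
    using unitary[of 1 1] unitary[of 2 1] by (simp_all add: matrix_matrix_mult_def sum_2 mat_def)
  have det: "?a * ?d - ?b * ?c = 1" using assms by (simp add: SU2_def det_2)
  have "?d = ?d * (?a * cnj ?a + ?b * cnj ?b)" by (simp add: e11)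
  also have "\<dots> = cnj ?a * (?a * ?d - ?b * ?c) + ?b * (?c * cnj ?a + ?d * cnj ?b)"
    by (simp add: algebra_simps)
  finally show "?d = cnj ?a" by (simp add: det e21)
  have "?c = ?c * (?a * cnj ?a + ?b * cnj ?b)" by (simp add: e11)
  also have "\<dots> = ?a * (?c * cnj ?a + ?d * cnj ?b) - cnj ?b * (?a * ?d - ?b * ?c)"
    by (simp add: algebra_simps)
  finally show "?c = - cnj ?b" by (simp add: det e21)
  have "complex_of_real ((cmod ?a)\<^sup>2 + (cmod ?b)\<^sup>2) = of_real 1"
    using e11 by (simp only: complex_norm_square of_real_add of_real_1)
  then show "(cmod ?a)\<^sup>2 + (cmod ?b)\<^sup>2 = 1" by (simp only: of_real_eq_iff)
qed

text \<open>
  The commutator of two quaternions is twice the cross product of their imaginary parts, so commuting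
  elements have parallel imaginary parts.
\<close>
lemma SU2_commute_parallel:
  assumes "A \<in> SU2" "B \<in> SU2" "A ** B = B ** A"
  shows "Im (A $ 1 $ 1) * Re (B $ 1 $ 2) = Im (B $ 1 $ 1) * Re (A $ 1 $ 2)"
    "Im (A $ 1 $ 1) * Im (B $ 1 $ 2) = Im (B $ 1 $ 1) * Im (A $ 1 $ 2)"
    "Re (A $ 1 $ 2) * Im (B $ 1 $ 2) = Re (B $ 1 $ 2) * Im (A $ 1 $ 2)"
proof -
  have "(A ** B) $ i $ j = (B ** A) $ i $ j" for i j using assms(3) by simp
  from this[of 1 1] this[of 1 2]
  have "A $ 1 $ 2 * cnj (B $ 1 $ 2) = B $ 1 $ 2 * cnj (A $ 1 $ 2)"
    and "A $ 1 $ 1 * B $ 1 $ 2 + A $ 1 $ 2 * cnj (B $ 1 $ 1) = B $ 1 $ 1 * A $ 1 $ 2 + B $ 1 $ 2 * cnj (A $ 1 $ 1)"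
    by (simp_all add: matrix_matrix_mult_def sum_2 SU2_entries[OF assms(1)] SU2_entries[OF assms(2)])
  then show "Im (A $ 1 $ 1) * Re (B $ 1 $ 2) = Im (B $ 1 $ 1) * Re (A $ 1 $ 2)"
    "Im (A $ 1 $ 1) * Im (B $ 1 $ 2) = Im (B $ 1 $ 1) * Im (A $ 1 $ 2)"
    "Re (A $ 1 $ 2) * Im (B $ 1 $ 2) = Re (B $ 1 $ 2) * Im (A $ 1 $ 2)"
    by (simp_all add: complex_eq_iff algebra_simps)
qed

text \<open>
  The four expressions are, up to sign and order, the components of the quaternion \<open>v\<^sub>1 + v\<^sub>2 i + v\<^sub>3 j + v\<^sub>4 k\<close> with
  \<open>v = (p, q, r)\<close>. For parallel imaginary quaternions \<open>v = u t\<close> this is a product of quaternions, and its norm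
  squared is the sum of those of the \<open>v\<close>: every mixed term in the expansion is a cross product.
\<close>
lemma quaternionic_block_zero:
  fixes p q r :: "nat \<Rightarrow> real"
  assumes par: "\<And>i j. i \<in> {k..k+3} \<Longrightarrow> j \<in> {k..k+3} \<Longrightarrow>
      p i * q j = p j * q i \<and> p i * r j = p j * r i \<and> q i * r j = q j * r i"
    and e: "p k - r (k+2) + q (k+3) = 0" "p (k+1) + q (k+2) + r (k+3) = 0"
      "p (k+2) + r k - q (k+1) = 0" "p (k+3) - q k - r (k+1) = 0"
    and i: "i \<in> {k..k+3}"
  shows "p i = 0 \<and> q i = 0 \<and> r i = 0"
proof -
  let ?s = "\<lambda>i. (p i)\<^sup>2 + (q i)\<^sup>2 + (r i)\<^sup>2"
  have par': "p (k+1) * q (k+2) = p (k+2) * q (k+1)" "p (k+1) * r (k+3) = p (k+3) * r (k+1)"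
    "q (k+2) * r (k+3) = q (k+3) * r (k+2)" "p (k+2) * r k = p k * r (k+2)"
    "p k * q (k+3) = p (k+3) * q k" "q k * r (k+1) = q (k+1) * r k"
    by (rule par[THEN conjunct1] par[THEN conjunct2, THEN conjunct1] par[THEN conjunct2, THEN conjunct2]; simp)+
  have "?s k + ?s (k+1) + ?s (k+2) + ?s (k+3) =
    (p k - r (k+2) + q (k+3))\<^sup>2 + (p (k+1) + q (k+2) + r (k+3))\<^sup>2
    + (p (k+2) + r k - q (k+1))\<^sup>2 + (p (k+3) - q k - r (k+1))\<^sup>2"
    using par' unfolding power2_eq_square by (simp add: algebra_simps)
  also have "\<dots> = 0" using e by simp
  finally have "?s k + ?s (k+1) + ?s (k+2) + ?s (k+3) = 0" .
  moreover have nn: "0 \<le> ?s j" for j by simp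
  ultimately have "?s k = 0" "?s (k+1) = 0" "?s (k+2) = 0" "?s (k+3) = 0"
    using nn[of k] nn[of "k+1"] nn[of "k+2"] nn[of "k+3"] by linarith+
  moreover have "i = k \<or> i = k+1 \<or> i = k+2 \<or> i = k+3" using i by auto
  ultimately have "?s i = 0" by auto
  then show ?thesis by (simp add: add_nonneg_eq_0_iff)
qed

text \<open>
  The tuple is cut into consecutive blocks of four, and the quaternion of each block is multiplied by \<open>-i\<close>
  on the left. Only this normalisation depends on the choice of torus: it makes the coordinate equal to
  \<open>Im\<close> of the diagonal entry on diagonal tuples.
\<close>
definition twisted_coordinate :: "(nat \<Rightarrow> complex^2^2) \<Rightarrow> nat \<Rightarrow> real"
  where "twisted_coordinate g i =
    (let p = \<lambda>j. Im (g j $ 1 $ 1); q = \<lambda>j. Re (g j $ 1 $ 2); r = \<lambda>j. Im (g j $ 1 $ 2); c = (i - 1) mod 4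
     in if c = 0 then p i - r (i + 2) + q (i + 3)
        else if c = 1 then p i + q (i + 1) + r (i + 2)
        else if c = 2 then p i + r (i - 2) - q (i - 1)
        else p i - q (i - 3) - r (i - 2))"

definition tuple_map :: "real \<Rightarrow> nat \<Rightarrow> (nat \<Rightarrow> complex^2^2) \<Rightarrow> nat \<Rightarrow> real"
  where "tuple_map s n g =
    (\<lambda>i. if i = 0 then (\<Sum>j\<in>{1..n}. 1 + Re (g j $ 1 $ 1)) + s
         else if i \<le> n then twisted_coordinate g i else 0)"

text \<open>
  The entries used by a coordinate stay inside its block, hence inside the tuple; this is where divisibility
  of the length by \<open>4\<close> enters.
\<close>
lemma block_indices:
  fixes i m :: nat
  assumes "1 \<le> i" "i \<le> 4 * m"
  shows "(i - 1) mod 4 = 0 \<Longrightarrow> i + 3 \<le> 4 * m"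
    "(i - 1) mod 4 = 1 \<Longrightarrow> i + 2 \<le> 4 * m"
    "(i - 1) mod 4 = 2 \<Longrightarrow> 3 \<le> i"
    "(i - 1) mod 4 \<notin> {0, 1, 2} \<Longrightarrow> 4 \<le> i"
proof -
  define t c where "t = (i - 1) div 4" and "c = (i - 1) mod 4"
  have "i - 1 = 4 * t + c" "c < 4" by (simp_all add: t_def c_def)
  then have i: "i = 4 * t + c + 1" using assms(1) by linarith
  then have "t < m" using assms(2) by linarith
  then have "4 * t + 4 \<le> 4 * m" by linarith
  then show "(i - 1) mod 4 = 0 \<Longrightarrow> i + 3 \<le> 4 * m" "(i - 1) mod 4 = 1 \<Longrightarrow> i + 2 \<le> 4 * m"
    "(i - 1) mod 4 = 2 \<Longrightarrow> 3 \<le> i" "(i - 1) mod 4 \<notin> {0, 1, 2} \<Longrightarrow> 4 \<le> i"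
    using \<open>c < 4\<close> unfolding c_def[symmetric] i by auto
qed

lemma continuous_map_tuple_entry:
  assumes "j \<in> {1..n}" "continuous_on UNIV f"
  shows "continuous_map (commuting_tuples n) euclidean (\<lambda>g. f (g j))"
proof -
  have "continuous_map (commuting_tuples n) (top_of_set SU2) (\<lambda>g. g j)"
    unfolding commuting_tuples_def
    by (intro continuous_map_from_subtopology continuous_map_product_projection assms(1))
  moreover have "continuous_map (top_of_set SU2) euclidean f"
    using assms(2) continuous_on_subset by auto
  ultimately show ?thesis
    using continuous_map_compose[of "commuting_tuples n" _ "\<lambda>g. g j" euclidean f] by (simp add: o_def)
qed

lemma continuous_map_tuple_map:
  assumes s: "s = 1 \<or> s = -1"
  shows "continuous_map (commuting_tuples (4 * m)) (punctured_space (4 * m)) (tuple_map s (4 * m))"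
  unfolding punctured_space_def continuous_map_in_subtopology
proof
  let ?n = "4 * m"
  have entry: "continuous_map (commuting_tuples ?n) euclideanreal (\<lambda>g. Re (g j $ a $ b))"
    "continuous_map (commuting_tuples ?n) euclideanreal (\<lambda>g. Im (g j $ a $ b))"
    if "1 \<le> j" "j \<le> ?n" for j a b
    by (rule continuous_map_tuple_entry; use that in \<open>auto intro!: continuous_intros\<close>)+
  have "continuous_map (commuting_tuples ?n) euclideanreal (\<lambda>g. twisted_coordinate g i)"
    if i: "1 \<le> i" "i \<le> ?n" for i
    unfolding twisted_coordinate_def Let_def
    using i block_indices[OF i]
    by (auto intro!: continuous_map_add continuous_map_diff entry)
  then have "continuous_map (commuting_tuples ?n) euclideanreal (\<lambda>g. tuple_map s ?n g i)" for i
    by (auto simp: tuple_map_def intro!: continuous_map_add continuous_map_sum entry)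
  then show "continuous_map (commuting_tuples ?n) (powertop_real UNIV) (tuple_map s ?n)"
    by (simp add: continuous_map_componentwise_UNIV)
  have "\<exists>i\<le>?n. tuple_map s ?n g i \<noteq> 0" if g: "g \<in> topspace (commuting_tuples ?n)" for g
  proof (rule ccontr)
    assume "\<not> ?thesis"
    then have 0: "tuple_map s ?n g i = 0" if "i \<le> ?n" for i using that by auto
    have SU: "g j \<in> SU2" if "1 \<le> j" "j \<le> ?n" for j using g that by (auto simp: topspace_commuting_tuples PiE_iff)
    have comm: "g i ** g j = g j ** g i" if "1 \<le> i" "i \<le> ?n" "1 \<le> j" "j \<le> ?n" for i j
      using g that by (auto simp: topspace_commuting_tuples)
    have tw: "twisted_coordinate g i = 0" if "1 \<le> i" "i \<le> ?n" for i
      using 0[of i] that by (simp add: tuple_map_def)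
    have "1 + Re (g j $ 1 $ 1) = 0 \<or> 1 + Re (g j $ 1 $ 1) = 2" if j: "j \<in> {1..?n}" for j
    proof -
      define t where "t = (j - 1) div 4"
      define k where "k = 4 * t + 1"
      have jk: "j \<in> {k..k+3}" and k: "1 \<le> k" "k + 3 \<le> ?n" and km: "(k - 1) mod 4 = 0"
        using j unfolding k_def t_def by auto presburger+
      have km': "(k + 1 - 1) mod 4 = 1" "(k + 2 - 1) mod 4 = 2" "(k + 3 - 1) mod 4 = 3"
        unfolding k_def by (simp_all add: mod_Suc)
      have tk: "twisted_coordinate g k = 0" "twisted_coordinate g (k + 1) = 0"
        "twisted_coordinate g (k + 2) = 0" "twisted_coordinate g (k + 3) = 0"
        using k by (auto intro!: tw)
      have "Im (g j $ 1 $ 1) = 0 \<and> Re (g j $ 1 $ 2) = 0 \<and> Im (g j $ 1 $ 2) = 0"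
      proof (rule quaternionic_block_zero[where k = k and i = j and p = "\<lambda>j. Im (g j $ 1 $ 1)"
              and q = "\<lambda>j. Re (g j $ 1 $ 2)" and r = "\<lambda>j. Im (g j $ 1 $ 2)", OF _ _ _ _ _ jk])
        show "Im (g a $ 1 $ 1) * Re (g b $ 1 $ 2) = Im (g b $ 1 $ 1) * Re (g a $ 1 $ 2) \<and>
            Im (g a $ 1 $ 1) * Im (g b $ 1 $ 2) = Im (g b $ 1 $ 1) * Im (g a $ 1 $ 2) \<and>
            Re (g a $ 1 $ 2) * Im (g b $ 1 $ 2) = Re (g b $ 1 $ 2) * Im (g a $ 1 $ 2)"
          if "a \<in> {k..k+3}" "b \<in> {k..k+3}" for a b
          using SU2_commute_parallel[OF SU SU comm, of a b] that k by auto
        show "Im (g k $ 1 $ 1) - Im (g (k + 2) $ 1 $ 2) + Re (g (k + 3) $ 1 $ 2) = 0"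
          using tk(1) km unfolding twisted_coordinate_def Let_def by simp
        show "Im (g (k + 1) $ 1 $ 1) + Re (g (k + 2) $ 1 $ 2) + Im (g (k + 3) $ 1 $ 2) = 0"
          using tk(2) unfolding twisted_coordinate_def Let_def km' by (simp add: eval_nat_numeral)
        show "Im (g (k + 2) $ 1 $ 1) + Im (g k $ 1 $ 2) - Re (g (k + 1) $ 1 $ 2) = 0"
          using tk(3) unfolding twisted_coordinate_def Let_def km' by (simp add: eval_nat_numeral)
        show "Im (g (k + 3) $ 1 $ 1) - Re (g k $ 1 $ 2) - Im (g (k + 1) $ 1 $ 2) = 0"
          using tk(4) unfolding twisted_coordinate_def Let_def km' by (simp add: eval_nat_numeral)
      qed
      then have "g j $ 1 $ 2 = 0" "Im (g j $ 1 $ 1) = 0" by (simp_all add: complex_eq_iff)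
      then have "(Re (g j $ 1 $ 1))\<^sup>2 = 1"
        using SU2_entries(3)[OF SU, of j] j by (simp add: cmod_power2)
      then show ?thesis by (auto simp: power2_eq_1_iff)
    qed
    then have "(\<Sum>j\<in>{1..?n}. 1 + Re (g j $ 1 $ 1)) + s \<noteq> 0"
      by (rule sum_zero_two_odd_shift) (use s in auto)
    then show False using 0[of 0] by (simp add: tuple_map_def)
  qed
  then show "tuple_map s ?n \<in> topspace (commuting_tuples ?n) \<rightarrow> {x. \<exists>i\<le>?n. x i \<noteq> 0}" by auto
qed

definition diagonal_SU2 :: "complex \<Rightarrow> complex^2^2"
  where "diagonal_SU2 x = (\<chi> i j. if i = j then if i = 1 then x else cnj x else 0)"

definition diagonal_tuple :: "nat \<Rightarrow> (nat \<Rightarrow> complex) \<Rightarrow> nat \<Rightarrow> complex^2^2"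
  where "diagonal_tuple n x = (\<lambda>i\<in>{1..n}. diagonal_SU2 (x i))"

lemma diagonal_SU2_in_SU2:
  assumes "norm x = 1" shows "diagonal_SU2 x \<in> SU2"
proof -
  have "x * cnj x = 1" using assms complex_norm_square[of x] by simp
  then show ?thesis
    by (simp add: SU2_def diagonal_SU2_def det_2 vec_eq_iff forall_2 matrix_matrix_mult_def sum_2 mat_def mult.commute)
qed

lemma diagonal_SU2_commute: "diagonal_SU2 x ** diagonal_SU2 y = diagonal_SU2 y ** diagonal_SU2 x"
  by (simp add: diagonal_SU2_def vec_eq_iff forall_2 matrix_matrix_mult_def sum_2)

lemma continuous_map_diagonal_tuple:
  "continuous_map (torus n) (commuting_tuples n) (diagonal_tuple n)"
  unfolding commuting_tuples_def continuous_map_in_subtopology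
proof
  have cont: "continuous_on UNIV diagonal_SU2"
  proof -
    have "continuous_on UNIV (\<lambda>x. if i = j then if i = 1 then x else cnj x else 0)" for i j :: 2
      by (cases "i = j"; cases "i = 1") (auto intro!: continuous_intros)
    then show ?thesis unfolding diagonal_SU2_def[abs_def] by (intro continuous_intros)
  qed
  have "continuous_map (torus n) (top_of_set SU2) (\<lambda>x. diagonal_tuple n x i)" if i: "i \<in> {1..n}" for i
    using continuous_map_torus_coordinate[OF i cont] i diagonal_SU2_in_SU2
    by (auto simp: continuous_map_in_subtopology diagonal_tuple_def topspace_torus PiE_iff)
  then show "continuous_map (torus n) (product_topology (\<lambda>_. top_of_set SU2) {1..n}) (diagonal_tuple n)"
    by (auto simp: continuous_map_componentwise diagonal_tuple_def)
  show "diagonal_tuple n \<in> topspace (torus n) \<rightarrow> {g. \<forall>i\<in>{1..n}. \<forall>j\<in>{1..n}. g i ** g j = g j ** g i}"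
    by (auto simp: diagonal_tuple_def diagonal_SU2_commute)
qed

lemma tuple_map_diagonal_tuple: "tuple_map s (4 * m) (diagonal_tuple (4 * m) x) = torus_map s (4 * m) x"
proof
  fix i
  have entries: "diagonal_tuple (4 * m) x j $ 1 $ 1 = x j" "diagonal_tuple (4 * m) x j $ 1 $ 2 = 0"
    if "1 \<le> j" "j \<le> 4 * m" for j
    using that by (simp_all add: diagonal_tuple_def diagonal_SU2_def)
  have tw: "twisted_coordinate (diagonal_tuple (4 * m) x) i = Im (x i)" if i: "1 \<le> i" "i \<le> 4 * m"
  proof -
    consider "(i - 1) mod 4 = 0" "i + 3 \<le> 4 * m" | "(i - 1) mod 4 = 1" "i + 2 \<le> 4 * m"
      | "(i - 1) mod 4 = 2" "3 \<le> i" | "(i - 1) mod 4 \<notin> {0, 1, 2}" "4 \<le> i"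
      using block_indices[OF i]
      by (cases "(i - 1) mod 4 = 0"; cases "(i - 1) mod 4 = 1"; cases "(i - 1) mod 4 = 2") auto
    then show ?thesis
      by cases (use i in \<open>simp_all add: twisted_coordinate_def Let_def entries\<close>)
  qed
  have "(\<Sum>j\<in>{1..4 * m}. 1 + Re (diagonal_tuple (4 * m) x j $ 1 $ 1)) = (\<Sum>j\<in>{1..4 * m}. 1 + Re (x j))"
    by (rule sum.cong) (auto simp: diagonal_tuple_def diagonal_SU2_def)
  then show "tuple_map s (4 * m) (diagonal_tuple (4 * m) x) i = torus_map s (4 * m) x i"
    using tw by (simp add: tuple_map_def torus_map_def)
qed

lemma commuting_tuples_cycle_not_even:
  "\<exists>z. singular_relcycle (4 * m) (commuting_tuples (4 * m)) {} z \<and> \<not> even_cycle (4 * m) (commuting_tuples (4 * m)) z"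
proof -
  let ?n = "4 * m" and ?Y = "commuting_tuples (4 * m)"
  obtain z where z: "singular_relcycle ?n (torus ?n) {} z"
    and odd: "\<not> even_cycle ?n (punctured_space ?n) (chain_map ?n (torus_map (-1) ?n) z - chain_map ?n (torus_map 1 ?n) z)"
    using torus_cycle_not_even by blast
  let ?z = "chain_map ?n (diagonal_tuple ?n) z"
  have push: "chain_map ?n (tuple_map s ?n) ?z = chain_map ?n (torus_map s ?n) z" for s
  proof -
    have "tuple_map s ?n \<circ> diagonal_tuple ?n = torus_map s ?n"
      by (simp add: fun_eq_iff tuple_map_diagonal_tuple)
    then show ?thesis by (metis chain_map_compose o_apply)
  qed
  have "\<not> even_cycle ?n ?Y ?z"
  proof
    assume e: "even_cycle ?n ?Y ?z"
    have "even_cycle ?n (punctured_space ?n) (chain_map ?n (tuple_map s ?n) ?z)" if "s = 1 \<or> s = -1" for s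
      by (rule even_cycle_chain_map[OF e continuous_map_tuple_map[OF that]])
    from even_cycle_diff[OF this this, of "-1" 1] show False using odd push by simp
  qed
  moreover have "singular_relcycle ?n ?Y {} ?z"
    by (rule singular_relcycle_chain_map[OF z continuous_map_diagonal_tuple]) simp
  ultimately show ?thesis by blast
qed

section \<open>Mod 2 cohomology detects odd cycles\<close>

text \<open>
  A hyperplane over the field with two elements: a subgroup that is maximal among those containing \<open>N\<close> and
  missing \<open>z\<close> has index \<open>2\<close>, because every element outside it is congruent to \<open>z\<close>.
\<close>
lemma mod2_functional:
  fixes N :: "'a::ab_group_add set"
  assumes zero: "0 \<in> N" and diff: "\<And>x y. x \<in> N \<Longrightarrow> y \<in> N \<Longrightarrow> x - y \<in> N"
    and double: "\<And>x. x + x \<in> N" and z: "z \<notin> N"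
  obtains \<psi> :: "'a \<Rightarrow> int" where "\<And>x. \<psi> x \<in> {0, 1}" "\<And>x y. \<psi> (x + y) = (\<psi> x + \<psi> y) mod 2"
    "\<And>x. x \<in> N \<Longrightarrow> \<psi> x = 0" "\<psi> z = 1"
proof -
  define \<A> where "\<A> = {M. N \<subseteq> M \<and> z \<notin> M \<and> (\<forall>x\<in>M. \<forall>y\<in>M. x - y \<in> M)}"
  have "\<exists>M\<in>\<A>. \<forall>X\<in>\<A>. M \<subseteq> X \<longrightarrow> X = M"
  proof (rule subset_Zorn_nonempty)
    show "\<A> \<noteq> {}" using diff z by (auto simp: \<A>_def)
    show "\<Union>\<C> \<in> \<A>" if ne: "\<C> \<noteq> {}" and ch: "subset.chain \<A> \<C>" for \<C>
    proof -
      have sub: "\<C> \<subseteq> \<A>" and tot: "\<And>X Y. X \<in> \<C> \<Longrightarrow> Y \<in> \<C> \<Longrightarrow> X \<subseteq> Y \<or> Y \<subseteq> X"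
        using ch by (auto simp: subset.chain_def)
      have "x - y \<in> \<Union>\<C>" if mem: "x \<in> \<Union>\<C>" "y \<in> \<Union>\<C>" for x y
      proof -
        obtain X Y where XY: "X \<in> \<C>" "Y \<in> \<C>" "x \<in> X" "y \<in> Y" using mem by blast
        then obtain W where W: "W \<in> \<C>" "x \<in> W" "y \<in> W" using tot[OF XY(1,2)] by blast
        then have "W \<in> \<A>" using sub by blast
        then show ?thesis using W by (auto simp: \<A>_def)
      qed
      moreover have "N \<subseteq> \<Union>\<C>" "z \<notin> \<Union>\<C>" using ne sub by (auto 0 3 simp: \<A>_def)
      ultimately show ?thesis by (auto simp: \<A>_def)
    qed
  qed
  then obtain M where M: "M \<in> \<A>" and max: "\<And>X. X \<in> \<A> \<Longrightarrow> M \<subseteq> X \<Longrightarrow> X = M" by auto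
  have NM: "N \<subseteq> M" and zM: "z \<notin> M" and dM: "\<And>x y. x \<in> M \<Longrightarrow> y \<in> M \<Longrightarrow> x - y \<in> M"
    using M by (auto simp: \<A>_def)
  have 0: "0 \<in> M" using zero NM by auto
  have mM: "- x \<in> M" if "x \<in> M" for x using dM[OF 0 that] by simp
  have aM: "x + y \<in> M" if "x \<in> M" "y \<in> M" for x y
    using dM[OF that(1) mM[OF that(2)]] by simp
  have two: "x + x \<in> M" for x using double NM by auto
  \<comment> \<open>By maximality, adjoining the coset of \<open>x\<close> must capture \<open>z\<close>.\<close>
  have outside: "x - z \<in> M" if x: "x \<notin> M" for x
  proof -
    define X where "X = M \<union> {y. y - x \<in> M}"
    have "u - v \<in> X" if uv: "u \<in> X" "v \<in> X" for u v
    proof -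
      consider "u \<in> M" "v \<in> M" | "u \<in> M" "v - x \<in> M" | "u - x \<in> M" "v \<in> M" | "u - x \<in> M" "v - x \<in> M"
        using uv by (auto simp: X_def)
      then show ?thesis
      proof cases
        case 2
        have "u - v - x = u - (v - x) - (x + x)" by simp
        also have "\<dots> \<in> M" by (rule dM[OF dM[OF 2] two])
        finally show ?thesis by (simp add: X_def)
      next
        case 3
        have "u - v - x = (u - x) - v" by simp
        also have "\<dots> \<in> M" by (rule dM[OF 3])
        finally show ?thesis by (simp add: X_def)
      next
        case 4
        have "u - v = (u - x) - (v - x)" by simp
        also have "\<dots> \<in> M" by (rule dM[OF 4])
        finally show ?thesis by (simp add: X_def)
      qed (auto simp: X_def dM)
    qed
    note X_diff = this
    have "x \<in> X" "N \<subseteq> X" "M \<subseteq> X" using 0 NM by (auto simp: X_def)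
    have "z \<in> X"
    proof (rule ccontr)
      assume "z \<notin> X"
      then have "X \<in> \<A>" using X_diff \<open>N \<subseteq> X\<close> by (simp add: \<A>_def)
      then show False using max[OF _ \<open>M \<subseteq> X\<close>] \<open>x \<in> X\<close> x by simp
    qed
    then have "z - x \<in> M" using zM by (simp add: X_def)
    from mM[OF this] have "x - z \<in> M" by simp
    then show ?thesis by simp
  qed
  define \<psi> :: "'a \<Rightarrow> int" where "\<psi> = (\<lambda>x. if x \<in> M then 0 else 1)"
  have "x + y \<in> M \<longleftrightarrow> (x \<in> M \<longleftrightarrow> y \<in> M)" for x y
  proof -
    have "x + y \<in> M" if "x \<notin> M" "y \<notin> M"
      using aM[OF aM[OF outside outside] two[of z], OF that] by (simp add: algebra_simps)
    moreover have "y \<in> M" if "x \<in> M" "x + y \<in> M" using dM[OF that(2,1)] by simp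
    moreover have "x \<in> M" if "y \<in> M" "x + y \<in> M" using dM[OF that(2,1)] by simp
    ultimately show ?thesis using aM by blast
  qed
  then show ?thesis
    by (intro that[of \<psi>]) (use NM zM in \<open>auto simp: \<psi>_def\<close>)
qed

lemma residue_ring_2_simps:
  "carrier (residue_ring 2) = {0, 1}" "\<zero>\<^bsub>residue_ring 2\<^esub> = 0" "\<one>\<^bsub>residue_ring 2\<^esub> = 1"
  "x \<oplus>\<^bsub>residue_ring 2\<^esub> y = (x + y) mod 2" "x \<otimes>\<^bsub>residue_ring 2\<^esub> y = (x * y) mod 2"
  by (auto simp: residue_ring_def)

lemma field_residue_ring_2: "field (residue_ring 2)"
proof -
  interpret residues_prime 2 "residue_ring 2"
    by unfold_locales simp_all
  show ?thesis by (rule is_field)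
qed

lemma cring_residue_ring_2: "cring (residue_ring 2)"
  using field_residue_ring_2 by (simp add: field_def domain_def)

lemma coboundary_residue_ring_2:
  assumes c: "c \<in> carrier (cochain_module (residue_ring 2) p X)" and \<sigma>: "singular_simplex (Suc p) X \<sigma>"
  shows "coboundary (residue_ring 2) p X c \<sigma> = (\<Sum>i\<le>Suc p. c (singular_face (Suc p) i \<sigma>)) mod 2"
proof -
  let ?R = "residue_ring 2"
  interpret F: cring ?R by (rule cring_residue_ring_2)
  have fin: "finsum ?R f A = (\<Sum>i\<in>A. f i) mod 2" if "finite A" "f \<in> A \<rightarrow> {0,1}" for f and A :: "nat set"
    using that
  proof (induction A)
    case (insert x A)
    then have "finsum ?R f (insert x A) = f x \<oplus>\<^bsub>?R\<^esub> finsum ?R f A"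
      by (intro F.finsum_insert) (auto simp: residue_ring_2_simps)
    then show ?case using insert by (simp add: residue_ring_2_simps mod_add_right_eq)
  qed (simp add: residue_ring_2_simps)
  have "\<ominus>\<^bsub>?R\<^esub> \<one>\<^bsub>?R\<^esub> = \<one>\<^bsub>?R\<^esub>"
    by (rule F.minus_equality) (auto simp: residue_ring_2_simps)
  then have sign: "(\<ominus>\<^bsub>?R\<^esub> \<one>\<^bsub>?R\<^esub>) [^]\<^bsub>?R\<^esub> i = \<one>\<^bsub>?R\<^esub>" for i :: nat by simp
  have ev: "c (singular_face (Suc p) i \<sigma>) \<in> {0, 1}" if "i \<le> Suc p" for i
    using c singular_simplex_face[OF \<sigma> that] by (auto simp: cochain_module_def residue_ring_2_simps(1) PiE_iff)
  have "coboundary ?R p X c \<sigma> = finsum ?R (\<lambda>i. c (singular_face (Suc p) i \<sigma>)) {..Suc p}"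
    unfolding coboundary_def sign using \<sigma> ev
    by (fastforce simp del: F.finsum_Suc intro!: F.finsum_cong' F.l_one simp: residue_ring_2_simps(1))
  also have "\<dots> = (\<Sum>i\<le>Suc p. c (singular_face (Suc p) i \<sigma>)) mod 2"
    using ev by (intro fin) auto
  finally show ?thesis .
qed

lemma additive_mod2_sign:
  fixes \<psi> :: "'a chain \<Rightarrow> int"
  assumes "\<And>x. \<psi> x \<in> {0, 1}" "\<And>x y. \<psi> (x + y) = (\<psi> x + \<psi> y) mod 2"
  shows "\<psi> (- x) = \<psi> x" "\<psi> 0 = 0" "\<psi> (frag_cmul ((-1) ^ i) x) = \<psi> x"
    "\<psi> (\<Sum>i\<in>A. f i) = (\<Sum>i\<in>A. \<psi> (f i)) mod 2"
proof -
  show 0: "\<psi> 0 = 0" using assms(1)[of 0] assms(2)[of 0 0] by auto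
  show m: "\<psi> (- x) = \<psi> x" for x
    using assms(1)[of x] assms(1)[of "-x"] assms(2)[of x "-x"] 0 by auto
  show "\<psi> (frag_cmul ((-1) ^ i) x) = \<psi> x"
    by (cases "even i") (simp_all add: m)
  show "\<psi> (\<Sum>i\<in>A. f i) = (\<Sum>i\<in>A. \<psi> (f i)) mod 2"
    by (induction A rule: infinite_finite_induct) (simp_all add: 0 assms(2) mod_add_right_eq)
qed

text \<open>
  Apply \<open>mod2_functional\<close> to the subgroup generated by boundaries and doubles of chains. A double
  \<open>a + a\<close> is allowed for every formal chain \<open>a\<close>, since if it is homologous to a cycle of \<open>X\<close> then \<open>a\<close> is
  itself a cycle of \<open>X\<close>. The functional is a cocycle because it kills boundaries, and it is not a
  coboundary because it does not vanish on the cycle \<open>z\<close>.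
\<close>
lemma cohomology_residue_ring_2_nontrivial:
  assumes z: "singular_relcycle (Suc p) X {} z" and odd: "\<not> even_cycle (Suc p) X z"
  shows "\<exists>A \<in> carrier (cohomology_module (residue_ring 2) (Suc p) X). A \<noteq> \<zero>\<^bsub>cohomology_module (residue_ring 2) (Suc p) X\<^esub>"
proof -
  let ?R = "residue_ring 2" and ?q = "Suc p"
  define N where "N = {x. \<exists>a b. singular_chain (Suc ?q) X b \<and> x = (a + a) + chain_boundary (Suc ?q) b}"
  have zc: "singular_chain ?q X z" and bz: "chain_boundary ?q z = 0"
    using z by (auto simp: singular_cycle)
  have zN: "z \<notin> N"
  proof
    assume "z \<in> N"
    then obtain a b where b: "singular_chain (Suc ?q) X b" and zab: "z = (a + a) + chain_boundary (Suc ?q) b"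
      by (auto simp: N_def)
    have aa: "a + a = z - chain_boundary (Suc ?q) b" using zab by simp
    have "singular_chain ?q X (a + a)"
      unfolding aa using zc b by (intro singular_chain_diff singular_chain_boundary_alt)
    moreover have "a + a = frag_cmul 2 a" by (metis frag_cmul_distrib frag_cmul_one one_add_one)
    ultimately have "singular_chain ?q X a"
      by (auto simp: singular_chain_def subset_iff)
    moreover have "chain_boundary ?q (a + a) = 0"
      unfolding aa using bz b by (simp add: chain_boundary_diff chain_boundary_boundary_alt)
    then have "chain_boundary ?q a = 0"
      using \<open>a + a = frag_cmul 2 a\<close> by (simp add: chain_boundary_cmul)
    ultimately have "singular_relcycle ?q X {} a" by (simp add: singular_cycle)
    moreover have "homologous_rel ?q X {} z (a + a)"
      unfolding homologous_rel_def singular_boundary using b zab by auto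
    ultimately show False using odd by (auto simp: even_cycle_def)
  qed
  obtain \<psi> :: "'a chain \<Rightarrow> int" where \<psi>: "\<And>x. \<psi> x \<in> {0, 1}" "\<And>x y. \<psi> (x + y) = (\<psi> x + \<psi> y) mod 2"
    and \<psi>N: "\<And>x. x \<in> N \<Longrightarrow> \<psi> x = 0" and \<psi>z: "\<psi> z = 1"
  proof (rule mod2_functional[of N z])
    show "0 \<in> N" unfolding N_def by (intro CollectI exI[of _ 0]) auto
    show "x + x \<in> N" for x unfolding N_def by (intro CollectI exI[of _ x] exI[of _ 0]) auto
    show "x - y \<in> N" if "x \<in> N" "y \<in> N" for x y
    proof -
      obtain a b where 1: "singular_chain (Suc ?q) X b" "x = (a + a) + chain_boundary (Suc ?q) b"
        using \<open>x \<in> N\<close> by (auto simp: N_def)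
      obtain a' b' where 2: "singular_chain (Suc ?q) X b'" "y = (a' + a') + chain_boundary (Suc ?q) b'"
        using \<open>y \<in> N\<close> by (auto simp: N_def)
      show ?thesis unfolding N_def
        by (intro CollectI exI[of _ "a - a'"] exI[of _ "b - b'"])
          (auto simp: 1 2 singular_chain_diff chain_boundary_diff)
    qed
  qed (use zN in auto)
  note sgn = additive_mod2_sign[of \<psi>, OF \<psi>]
  define c where "c = (\<lambda>\<sigma>\<in>singular_simplex_set ?q X. \<psi> (frag_of \<sigma>))"
  have cC: "c \<in> carrier (cochain_module ?R ?q X)"
    using \<psi>(1) by (auto simp: c_def cochain_module_def residue_ring_2_simps)
  have "coboundary ?R ?q X c = \<zero>\<^bsub>cochain_module ?R (Suc ?q) X\<^esub>"
  proof -
    have "coboundary ?R ?q X c \<sigma> = 0" if \<sigma>: "singular_simplex (Suc ?q) X \<sigma>" for \<sigma>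
    proof -
      have "coboundary ?R ?q X c \<sigma> = (\<Sum>i\<le>Suc ?q. \<psi> (frag_of (singular_face (Suc ?q) i \<sigma>))) mod 2"
        unfolding coboundary_residue_ring_2[OF cC \<sigma>]
        using singular_simplex_face[OF \<sigma>] by (intro arg_cong[where f = "\<lambda>x. x mod 2"] sum.cong) (auto simp: c_def)
      also have "\<dots> = \<psi> (chain_boundary (Suc ?q) (frag_of \<sigma>))"
        by (simp add: chain_boundary_of sgn del: sum.atMost_Suc)
      also have "\<dots> = 0"
        using \<sigma> unfolding N_def
        by (intro \<psi>N[unfolded N_def] CollectI exI[of _ "0 :: 'a chain"] exI[of _ "frag_of \<sigma>"])
          (simp add: singular_chain_of)
      finally show ?thesis .
    qed
    then show ?thesis
      by (auto simp: fun_eq_iff cochain_module_def residue_ring_2_simps coboundary_def)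
  qed
  then have c: "c \<in> cocycles ?R ?q X" using cC by (simp add: cocycles_def)
  have not: "c \<notin> coboundaries ?R ?q X"
  proof
    assume "c \<in> coboundaries ?R ?q X"
    then obtain b where b: "b \<in> carrier (cochain_module ?R p X)" and cb: "c = coboundary ?R p X b"
      by (auto simp: coboundaries_def)
    \<comment> \<open>The integral extension of the cochain \<open>b\<close> to chains, computed in the free abelian group on one point.\<close>
    define e where "e = (\<lambda>x. Poly_Mapping.lookup (frag_extend (\<lambda>\<sigma>. frag_cmul (b \<sigma>) (frag_of ())) x) ())"
    have e_diff: "e (x - y) = e x - e y" for x y by (simp add: e_def frag_extend_diff lookup_minus)
    have e_add: "e (x + y) = e x + e y" for x y by (simp add: e_def frag_extend_add lookup_add)
    have e_of: "e (frag_of \<sigma>) = b \<sigma>" for \<sigma> by (simp add: e_def)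
    have e0: "e 0 = 0" by (simp add: e_def)
    have e_sign: "even (e (frag_cmul ((-1) ^ i) x) - e x)" for i x
      by (cases "even i") (simp_all add: e_def frag_extend_minus)
    have e_sum: "even (e (\<Sum>i\<in>A. frag_cmul ((-1) ^ i) (frag_of (f i))) - (\<Sum>i\<in>A. b (f i)))" for f and A :: "nat set"
    proof (induction A rule: infinite_finite_induct)
      case (insert i A)
      then show ?case using e_sign[of i "frag_of (f i)"] by (simp add: e_add e_of)
    qed (simp_all add: e0)
    have "even (\<psi> x - e (chain_boundary ?q x))" if "singular_chain ?q X x" for x
      using that[unfolded singular_chain_def]
    proof (induction x rule: frag_induction)
      case zero show ?case by (simp add: sgn e0)
    next
      case (one \<sigma>)
      then have \<sigma>: "singular_simplex ?q X \<sigma>" by simp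
      have "\<psi> (frag_of \<sigma>) = (\<Sum>i\<le>?q. b (singular_face ?q i \<sigma>)) mod 2"
        using coboundary_residue_ring_2[OF b \<sigma>] \<sigma> cb by (simp add: c_def fun_eq_iff del: sum.atMost_Suc) metis
      then have "even (\<psi> (frag_of \<sigma>) - (\<Sum>i\<le>?q. b (singular_face ?q i \<sigma>)))"
        by (simp del: sum.atMost_Suc)
      then show ?case
        using e_sum[of "\<lambda>i. singular_face ?q i \<sigma>" "{..?q}"]
        by (simp add: chain_boundary_of del: sum.atMost_Suc)
    next
      case (diff x y)
      have "\<psi> (x - y) = (\<psi> x + \<psi> y) mod 2" using \<psi>(2)[of x "- y"] by (simp add: sgn)
      then show ?case using diff by (simp add: chain_boundary_diff e_diff)
    qed
    from this[OF zc] show False by (simp add: bz \<psi>z e0)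
  qed
  interpret B: abelian_subgroup "coboundaries ?R ?q X" "cochain_module ?R ?q X"
    by (rule submodule_abelian_subgroup[OF module_cochain_module submodule_coboundaries])
       (rule cring_residue_ring_2)+
  let ?A = "coboundaries ?R ?q X +>\<^bsub>cochain_module ?R ?q X\<^esub> c"
  have "c \<in> ?A" using cC by (rule B.a_rcos_self)
  then have "?A \<noteq> \<zero>\<^bsub>cohomology_module ?R ?q X\<^esub>"
    using not by (auto simp: cohomology_module_def quotient_module_simps)
  then show ?thesis using c by (auto simp: carrier_cohomology_module)
qed

section \<open>Finite generation bounds the degree\<close>

text \<open>
  The elements supported below a degree bound for the generators form a sub-FI-module, since the structure
  maps act degree by degree.
\<close>
lemma finitely_generated_imp_bounded_degree:
  assumes R: "cring F"
    and fg: "fi_finitely_generated F (commuting_cohomology F) (commuting_cohomology_map F)"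
  obtains P where "\<And>n p A. P \<le> p \<Longrightarrow> A \<in> carrier (cohomology_module F p (commuting_tuples n)) \<Longrightarrow>
    A = \<zero>\<^bsub>cohomology_module F p (commuting_tuples n)\<^esub>"
proof -
  let ?H = "\<lambda>n p. cohomology_module F p (commuting_tuples n)"
  let ?V = "commuting_cohomology F" and ?T = "commuting_cohomology_map F"
  have carrier: "carrier (?V n) = {x. (\<forall>p. x p \<in> carrier (?H n p)) \<and> finite {p. x p \<noteq> \<zero>\<^bsub>?H n p\<^esub>}}" for n
    by (simp add: commuting_cohomology_def total_cohomology_def direct_sum_module_def)
  have H: "module F (?H n p)" for n p by (rule module_cohomology_module[OF R])
  have V: "module F (?V n)" for n
    unfolding commuting_cohomology_def total_cohomology_def by (intro module_direct_sum_module R H)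
  from fg obtain G where G: "G \<subseteq> (SIGMA m:UNIV. carrier (?V m))" "finite G"
    and gen: "\<forall>W. sub_fi_module F ?V ?T W \<and> G \<subseteq> (SIGMA m:UNIV. W m) \<longrightarrow> (\<forall>n. W n = carrier (?V n))"
    unfolding fi_finitely_generated_def by (elim exE conjE) (rule that)
  define D where "D = (\<Union>(m, x)\<in>G. {p. x p \<noteq> \<zero>\<^bsub>?H m p\<^esub>})"
  have "finite D" unfolding D_def using G by (force simp: carrier)
  then obtain P where "\<forall>p\<in>D. p < P"
    unfolding finite_nat_set_iff_bounded by (elim exE) (rule that)
  then have P: "p < P" if "p \<in> D" for p using that by simp
  define W where "W = (\<lambda>n. {x \<in> carrier (?V n). \<forall>p\<ge>P. x p = \<zero>\<^bsub>?H n p\<^esub>})"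
  have "submodule (W n) F (?V n)" for n
  proof (rule module.submoduleI[OF V])
    interpret V: module F "?V n" by (rule V)
    interpret Hp: module F "?H n p" for p by (rule H)
    have add: "(x \<oplus>\<^bsub>?V n\<^esub> y) p = x p \<oplus>\<^bsub>?H n p\<^esub> y p" and smult: "(a \<odot>\<^bsub>?V n\<^esub> x) p = a \<odot>\<^bsub>?H n p\<^esub> x p"
      and zero: "\<zero>\<^bsub>?V n\<^esub> p = \<zero>\<^bsub>?H n p\<^esub>" for x y a p
      by (simp_all add: commuting_cohomology_def total_cohomology_def direct_sum_module_def)
    show "W n \<subseteq> carrier (?V n)" by (auto simp: W_def)
    show "\<zero>\<^bsub>?V n\<^esub> \<in> W n" by (simp add: W_def zero)
    show "x \<oplus>\<^bsub>?V n\<^esub> y \<in> W n" if "x \<in> W n" "y \<in> W n" for x y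
      using that by (simp add: W_def add)
    show "a \<odot>\<^bsub>?V n\<^esub> x \<in> W n" if "a \<in> carrier F" "x \<in> W n" for a x
      using that by (simp add: W_def smult)
    show "\<ominus>\<^bsub>?V n\<^esub> x \<in> W n" if "x \<in> W n" for x
    proof -
      have x: "x \<in> carrier (?V n)" "\<forall>p\<ge>P. x p = \<zero>\<^bsub>?H n p\<^esub>" using that by (auto simp: W_def)
      have "(\<ominus>\<^bsub>?V n\<^esub> x) p = \<zero>\<^bsub>?H n p\<^esub>" if "P \<le> p" for p
      proof -
        have "(\<ominus>\<^bsub>?V n\<^esub> x) p \<in> carrier (?H n p)" using V.a_inv_closed[OF x(1)] by (simp add: carrier)
        moreover have "(\<ominus>\<^bsub>?V n\<^esub> x \<oplus>\<^bsub>?V n\<^esub> x) p = \<zero>\<^bsub>?H n p\<^esub>"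
          using V.l_neg[OF x(1)] zero by simp
        ultimately show ?thesis using x(2) that by (simp add: add)
      qed
      then show ?thesis using V.a_inv_closed[OF x(1)] by (simp add: W_def)
    qed
  qed
  moreover have "?T m n f ` W m \<subseteq> W n" if f: "f \<in> fi_hom m n" for m n f
  proof (rule image_subsetI)
    fix x assume x: "x \<in> W m"
    note hom = cohomology_map_module_hom[OF R continuous_map_reindex[OF f]]
    have "?T m n f x \<in> carrier (?V n)"
    proof -
      have "?T m n f \<in> mod_hom F (?V m) (?V n)"
        using module_hom_direct_sum[where h = "\<lambda>p. cohomology_map F p (commuting_tuples n) (reindex m f)", OF H H hom]
        by (simp add: commuting_cohomology_def total_cohomology_def commuting_cohomology_map_def
            total_cohomology_map_def[abs_def])
      from module_homD(1)[OF this] show ?thesis using x by (simp add: W_def)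
    qed
    moreover have "?T m n f x p = \<zero>\<^bsub>?H n p\<^esub>" if "P \<le> p" for p
      using x that module_hom_zero_minus(1)[OF H H hom]
      by (simp add: W_def commuting_cohomology_map_def total_cohomology_map_def)
    ultimately show "?T m n f x \<in> W n" by (simp add: W_def)
  qed
  ultimately have "sub_fi_module F ?V ?T W" by (auto simp: sub_fi_module_def)
  moreover have "G \<subseteq> (SIGMA m:UNIV. W m)"
  proof
    fix y assume y: "y \<in> G"
    obtain m x where [simp]: "y = (m, x)" by (cases y)
    have "x p = \<zero>\<^bsub>?H m p\<^esub>" if "P \<le> p" for p
      using P[of p] that y by (force simp: D_def)
    moreover have "x \<in> carrier (?V m)" using G y by auto
    ultimately show "y \<in> (SIGMA m:UNIV. W m)" by (simp add: W_def)
  qed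
  ultimately have all: "W n = carrier (?V n)" for n using gen[rule_format, of W, OF conjI] by simp
  show ?thesis
  proof (rule that[of P])
    fix n p A assume p: "P \<le> p" and A: "A \<in> carrier (?H n p)"
    define x where "x = (\<lambda>q. if q = p then A else \<zero>\<^bsub>?H n q\<^esub>)"
    have "\<zero>\<^bsub>?H n q\<^esub> \<in> carrier (?H n q)" for q
    proof -
      interpret Hq: module F "?H n q" by (rule H)
      show ?thesis by simp
    qed
    then have "x \<in> carrier (?V n)" using A by (auto simp: carrier x_def)
    then have "x \<in> W n" using all by simp
    then have "x p = \<zero>\<^bsub>?H n p\<^esub>" using p by (simp add: W_def)
    then show "A = \<zero>\<^bsub>?H n p\<^esub>" by (simp add: x_def)
  qed
qed

theorem corollary5p1:
  shows "fi_module (residue_ring 2) (commuting_cohomology (residue_ring 2))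
           (commuting_cohomology_map (residue_ring 2)) \<and>
         \<not> fi_finitely_generated (residue_ring 2) (commuting_cohomology (residue_ring 2))
           (commuting_cohomology_map (residue_ring 2))"
proof
  show "fi_module (residue_ring 2) (commuting_cohomology (residue_ring 2))
      (commuting_cohomology_map (residue_ring 2))"
    by (rule fi_module_commuting_cohomology[OF field_residue_ring_2])
  show "\<not> fi_finitely_generated (residue_ring 2) (commuting_cohomology (residue_ring 2))
      (commuting_cohomology_map (residue_ring 2))"
  proof
    assume "fi_finitely_generated (residue_ring 2) (commuting_cohomology (residue_ring 2))
      (commuting_cohomology_map (residue_ring 2))"
    from finitely_generated_imp_bounded_degree[OF cring_residue_ring_2 this]
    obtain P where P: "\<And>n p A. P \<le> p \<Longrightarrow> A \<in> carrier (cohomology_module (residue_ring 2) p (commuting_tuples n)) \<Longrightarrow>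
      A = \<zero>\<^bsub>cohomology_module (residue_ring 2) p (commuting_tuples n)\<^esub>"
      by blast
    define n where "n = 4 * Suc P"
    then obtain p where p: "n = Suc p" by (cases n) auto
    have "P \<le> n" by (simp add: n_def)
    moreover obtain z where "singular_relcycle n (commuting_tuples n) {} z" "\<not> even_cycle n (commuting_tuples n) z"
      using commuting_tuples_cycle_not_even[of "Suc P"] unfolding n_def by blast
    then obtain A where "A \<in> carrier (cohomology_module (residue_ring 2) n (commuting_tuples n))"
      "A \<noteq> \<zero>\<^bsub>cohomology_module (residue_ring 2) n (commuting_tuples n)\<^esub>"
      using cohomology_residue_ring_2_nontrivial[of p "commuting_tuples n"] p by auto
    ultimately show False using P by blast
  qed
qed

end
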